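(* Suppose that $m,n\to\infty$ with $0<n\le m$ and $n/m\to\alpha\in[0,1]$. Then \begin{align*} \mathrm{Var}\bigl(d^{\mathsf U}(\mathcal T_{m,n})\bigr)&\to\mathrm{Var}\,D^{\mathsf U}_\alpha=-\tfrac1{16}e^{4\alpha}+\tfrac49e^{3\alpha}-\bigl(\tfrac14\alpha+\tfrac18\bigr)e^{2\alpha}-\tfrac14\alpha^2+\tfrac5{12}\alpha-\tfrac{37}{144},\\ \mathrm{Var}\bigl(d^{\mathsf L}(\mathcal T_{m,n})\bigr)&\to\mathrm{Var}\,D^{\mathsf L}_\alpha=-\tfrac1{64}\Bigl(\frac{e^{2\alpha}-1}{\alpha}\Bigr)^2+\frac{64e^{2\alpha}+37e^\alpha+37}{432}\cdot\frac{e^\alpha-1}{\alpha}-\tfrac1{16}e^{2\alpha}-\tfrac1{16}\alpha^2+\tfrac5{24}\alpha-\tfrac7{36},\\ \mathrm{Var}\bigl(d^{\mathsf E}(\mathcal T_{m,n})\bigr)&\to\mathrm{Var}\,D^{\mathsf E}_\alpha=\frac{\alpha-2}{2}\Bigl(\frac{e^\alpha-1}{\alpha}\Bigr)^2+2\,\frac{e^\alpha-1}{\alpha}-1, \end{align*} and, for the number of probes in an unsuccessful search, $$\mathrm{Var}\bigl(\widetilde d^{\mathsf U}(\mathcal T_{m,n})\bigr)\to\mathrm{Var}\,\widetilde D^{\mathsf U}_\alpha=-\tfrac1{16}e^{4\alpha}+\tfrac49e^{3\alpha}+\bigl(\tfrac14\alpha-\tfrac58\bigr)e^{2\alpha}-\tfrac14\alpha^2-\tfrac1{12}\alpha+\tfrac{35}{144},$$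 where for $\alpha=0$ the expressions on the right are interpreted as their limits as $\alpha\to0$.
   Context: Hashing with coalesced chains. Let $0\le n\le m$ be integers. Items $x_1,\dots,x_n$ are placed sequentially into a table with $m$ cells $1,\dots,m$, using hash addresses $h_1,\dots,h_n\in\{1,\dots,m\}$. Each cell has a link field, initially null. If cell $h_i$ is empty, $x_i$ is inserted there (creating a new chain of length 1). If cell $h_i$ is occupied, $x_i$ is stored in the empty cell $j$ with largest index, and $j$ is linked into the chain containing $h_i$ according to one of two policies: - $\mathsf L$ (late-insertion): follow the links from $h_i$ to the end of the chain (a null link) and append a link there to cell $j$. - $\mathsf E$ (early-insertion): cell $j$ is linked into the chain immediately after $h_i$: if the link from $h_i$ points to $k$ (null or not), this link is reset to $j$, and the link of $j$ is set to $k$. Both policies give the same occupied cells and the same partition of them into chains; only the order within chains may differ. A hash table $\mathcal T$ is encoded by $m$, $n$ and $(h_1,\dots,h_n)$, and both policies are considered together. The random hash table $\mathcal T_{m,n}$ has $m$ cells and $n$ items, with $h_1,\dots,h_n$ i.i.d. uniform on $\{1,\dots,m\}$. For $\Xi\in\{\mathsf L,\mathsf E\}$, $d_i^\Xi(\mathcal T)$ is the final displacement of item $x_i$, i.e. the number of links one has to follow from $h_i$ until $x_i$ is found in the final table (built with policy $\Xi$); and, if $n>0$, $d^\Xi(\mathcal T):=d_I^\Xi(\mathcal T)$ where $I$ is uniform on $\{1,\dots,n\}$, independent of $\mathcal T$. For an unsuccessful search starting at cell $j$, $d_j^{\mathsf U}(\mathcal T)$ is the number of occupied cells encountered: $0$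 if cell $j$ is empty, and otherwise $1$ plus the number of cells after $j$ in its chain. Put $d^{\mathsf U}(\mathcal T):=d_J^{\mathsf U}(\mathcal T)$ where $J$ is uniform on $\{1,\dots,m\}$, independent of $\mathcal T$ (its distribution is the same for both policies). The number of probes in a random unsuccessful search is $\widetilde d^{\mathsf U}(\mathcal T):=\max(d^{\mathsf U}(\mathcal T),1)$. For $\alpha\in[0,1]$ and $\Xi\in\{\mathsf U,\mathsf L,\mathsf E\}$, $D^\Xi_\alpha$ is a random variable with $\mathbb P(D^\Xi_\alpha=k)=p^\Xi_\alpha(k)$, $k=0,1,\dots$, where $p^{\mathsf U}_\alpha(0)=1-\alpha$ and $p^{\mathsf U}_\alpha(k)=\int_0^\alpha(1-\alpha+t)(1-e^{-t})^{k-1}\,dt$ for $k\ge1$; $p^{\mathsf L}_\alpha(0)=1-\alpha/2$ and $p^{\mathsf L}_\alpha(k)=\frac1\alpha\int_0^\alpha\bigl(\alpha-t-(\alpha-t)^2/2\bigr)(1-e^{-t})^{k-1}\,dt$ for $k\ge1$; $p^{\mathsf E}_\alpha(0)=1-\alpha/2$ and $p^{\mathsf E}_\alpha(k)=\frac1\alpha\int_0^\alpha(\alpha-t)e^{-t}(1-e^{-t})^{k-1}\,dt$ for $k\ge1$; for $\alpha=0$, $p^{\mathsf L}_0(k)=p^{\mathsf E}_0(k)=0$ when $k\ge1$. Furthermore $\widetilde D^{\mathsf U}_\alpha:=\max(D^{\mathsf U}_\alpha,1)$. *)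

theory Defs
  imports "HOL-Probability.Probability"
begin

section \<open>Hash tables with coalesced chains\<close>

text \<open>
  Cells and items are numbered \<open>1, \<dots>, m\<close> and \<open>1, \<dots>, n\<close>. The null link is \<^term>\<open>None\<close>, and
  \<open>item T c = Some i\<close> means that cell \<open>c\<close> holds \<open>x\<^sub>i\<close>. Hash addresses are given by a function \<open>h\<close>
  of which only the values on \<open>{1..n}\<close> matter.
\<close>

datatype policy = Late | Early

record table =
  item :: "nat \<Rightarrow> nat option"
  link :: "nat \<Rightarrow> nat option"

definition empty_table :: table where
  "empty_table = \<lparr>item = (\<lambda>_. None), link = (\<lambda>_. None)\<rparr>"

text \<open>The cell reached from \<open>c\<close> by following \<open>r\<close> links; \<^term>\<open>None\<close> if a null link is followed.\<close>

definition follow :: "table \<Rightarrow> nat \<Rightarrow> nat \<Rightarrow> nat option" where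
  "follow T r c = ((\<lambda>x. Option.bind x (link T)) ^^ r) (Some c)"

text \<open>The number of cells after \<open>c\<close> in its chain (chains never contain a cycle).\<close>

definition cells_after :: "table \<Rightarrow> nat \<Rightarrow> nat" where
  "cells_after T c = (LEAST r. follow T (Suc r) c = None)"

definition chain_end :: "table \<Rightarrow> nat \<Rightarrow> nat" where
  "chain_end T c = the (follow T (cells_after T c) c)"

definition last_empty_cell :: "nat \<Rightarrow> table \<Rightarrow> nat" where
  "last_empty_cell m T = Max {c \<in> {1..m}. item T c = None}"

fun insert_item :: "policy \<Rightarrow> nat \<Rightarrow> nat \<Rightarrow> nat \<Rightarrow> table \<Rightarrow> table" where
  "insert_item \<Xi> m i a T =
     (if item T a = None then T\<lparr>item := (item T)(a := Some i)\<rparr>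
      else let j = last_empty_cell m T in
        T\<lparr>item := (item T)(j := Some i),
          link := (case \<Xi> of
             Late \<Rightarrow> (link T)(chain_end T a := Some j)
           | Early \<Rightarrow> (link T)(j := link T a, a := Some j))\<rparr>)"

fun hash_table :: "policy \<Rightarrow> nat \<Rightarrow> nat \<Rightarrow> (nat \<Rightarrow> nat) \<Rightarrow> table" where
  "hash_table \<Xi> m 0 h = empty_table"
| "hash_table \<Xi> m (Suc n) h = insert_item \<Xi> m (Suc n) (h (Suc n)) (hash_table \<Xi> m n h)"

definition displacement :: "policy \<Rightarrow> nat \<Rightarrow> nat \<Rightarrow> (nat \<Rightarrow> nat) \<Rightarrow> nat \<Rightarrow> nat" where
  "displacement \<Xi> m n h i =
     (let T = hash_table \<Xi> m n h
      in LEAST r. \<exists>c. follow T r (h i) = Some c \<and> item T c = Some i)"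

definition unsuccessful_search :: "policy \<Rightarrow> nat \<Rightarrow> nat \<Rightarrow> (nat \<Rightarrow> nat) \<Rightarrow> nat \<Rightarrow> nat" where
  "unsuccessful_search \<Xi> m n h j =
     (let T = hash_table \<Xi> m n h
      in if item T j = None then 0 else 1 + cells_after T j)"

section \<open>Random hash tables\<close>

definition random_hashes :: "nat \<Rightarrow> nat \<Rightarrow> (nat \<Rightarrow> nat) pmf" where
  "random_hashes m n = Pi_pmf {1..n} 0 (\<lambda>_. pmf_of_set {1..m})"

text \<open>
  The laws of the random variables \<open>d\<^sup>L(\<T>\<^sub>m\<^sub>,\<^sub>n)\<close>, \<open>d\<^sup>E(\<T>\<^sub>m\<^sub>,\<^sub>n)\<close> (for \<open>n > 0\<close>) and \<open>d\<^sup>U(\<T>\<^sub>m\<^sub>,\<^sub>n)\<close> (for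
  \<open>m > 0\<close>).
\<close>

definition d_successful :: "policy \<Rightarrow> nat \<Rightarrow> nat \<Rightarrow> nat pmf" where
  "d_successful \<Xi> m n =
     map_pmf (\<lambda>(h, i). displacement \<Xi> m n h i)
       (pair_pmf (random_hashes m n) (pmf_of_set {1..n}))"

definition d_unsuccessful :: "policy \<Rightarrow> nat \<Rightarrow> nat \<Rightarrow> nat pmf" where
  "d_unsuccessful \<Xi> m n =
     map_pmf (\<lambda>(h, j). unsuccessful_search \<Xi> m n h j)
       (pair_pmf (random_hashes m n) (pmf_of_set {1..m}))"

text \<open>The law of \<open>max(X, 1)\<close>, for \<open>X\<close> with the given law.\<close>

definition probes :: "nat pmf \<Rightarrow> nat pmf" where
  "probes = map_pmf (\<lambda>k. max k 1)"

definition Var :: "nat pmf \<Rightarrow> real" where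
  "Var P = measure_pmf.variance P real"

section \<open>The limit distributions\<close>

definition p_U :: "real \<Rightarrow> nat \<Rightarrow> real" where
  "p_U \<alpha> k =
     (if k = 0 then 1 - \<alpha>
      else integral {0..\<alpha>} (\<lambda>t. (1 - \<alpha> + t) * (1 - exp (- t)) ^ (k - 1)))"

text \<open>For \<open>\<alpha> = 0\<close> and \<open>k \<ge> 1\<close> the next two expressions are \<open>0\<close>, since \<open>1 / 0 = 0\<close>.\<close>

definition p_L :: "real \<Rightarrow> nat \<Rightarrow> real" where
  "p_L \<alpha> k =
     (if k = 0 then 1 - \<alpha> / 2
      else 1 / \<alpha> * integral {0..\<alpha>}
        (\<lambda>t. (\<alpha> - t - (\<alpha> - t)\<^sup>2 / 2) * (1 - exp (- t)) ^ (k - 1)))"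

definition p_E :: "real \<Rightarrow> nat \<Rightarrow> real" where
  "p_E \<alpha> k =
     (if k = 0 then 1 - \<alpha> / 2
      else 1 / \<alpha> * integral {0..\<alpha>} (\<lambda>t. (\<alpha> - t) * exp (- t) * (1 - exp (- t)) ^ (k - 1)))"

text \<open>
  The laws of the random variables \<open>D\<close>. That \<^const>\<open>p_U\<close>, \<^const>\<open>p_L\<close> and \<^const>\<open>p_E\<close> are
  probability mass functions, as \<^const>\<open>embed_pmf\<close> requires, is proved below.
\<close>

definition D_U :: "real \<Rightarrow> nat pmf" where "D_U \<alpha> = embed_pmf (p_U \<alpha>)"
definition D_L :: "real \<Rightarrow> nat pmf" where "D_L \<alpha> = embed_pmf (p_L \<alpha>)"
definition D_E :: "real \<Rightarrow> nat pmf" where "D_E \<alpha> = embed_pmf (p_E \<alpha>)"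

lemma geometric_mixture_sums:
  fixes f :: "real \<Rightarrow> real"
  assumes f: "continuous_on {0..a} f" "\<And>t. t \<in> {0..a} \<Longrightarrow> 0 \<le> f t"
    and c: "((\<lambda>t. f t * exp t) has_integral c) {0..a}" and a: "0 \<le> a"
  shows "(\<lambda>k. integral {0..a} (\<lambda>t. f t * (1 - exp (- t)) ^ k)) sums c"
proof -
  define q where "q = 1 - exp (- a)"
  have q: "0 \<le> q" "q < 1" using a by (auto simp: q_def)
  define R where "R N = integral {0..a} (\<lambda>t. f t * exp t * (1 - exp (- t)) ^ N)" for N :: nat
  have int1: "(\<lambda>t. f t * (1 - exp (- t)) ^ k) integrable_on {0..a}" for k :: nat
    by (intro integrable_continuous_real continuous_intros f)
  have int2: "(\<lambda>t. f t * exp t * (1 - exp (- t)) ^ k) integrable_on {0..a}" for k :: nat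
    by (intro integrable_continuous_real continuous_intros f)
  have c': "(\<lambda>t. f t * exp t) integrable_on {0..a}" "integral {0..a} (\<lambda>t. f t * exp t) = c"
    using c by (auto simp: has_integral_iff)
  have part: "(\<Sum>k<N. integral {0..a} (\<lambda>t. f t * (1 - exp (- t)) ^ k)) = c - R N" for N
  proof -
    have geo: "(\<Sum>k<N. f t * (1 - exp (- t)) ^ k)
        = f t * exp t - f t * exp t * (1 - exp (- t)) ^ N" for t
    proof (induction N)
      case (Suc N)
      have "f t * exp t * exp (- t) = f t" by (simp add: mult.assoc flip: exp_add)
      then have "f t * exp t * (1 - exp (- t)) ^ Suc N
          = f t * exp t * (1 - exp (- t)) ^ N - f t * (1 - exp (- t)) ^ N"
        by (simp add: right_diff_distrib left_diff_distrib mult.assoc[symmetric])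
      then show ?case using Suc by simp
    qed simp
    have "(\<Sum>k<N. integral {0..a} (\<lambda>t. f t * (1 - exp (- t)) ^ k))
        = integral {0..a} (\<lambda>t. \<Sum>k<N. f t * (1 - exp (- t)) ^ k)"
      by (rule integral_sum[symmetric]) (auto intro: int1)
    also have "\<dots> = c - R N"
      unfolding geo R_def by (subst integral_diff) (use c' int2 in auto)
    finally show ?thesis .
  qed
  have R0: "0 \<le> R N" for N
    unfolding R_def by (intro integral_nonneg int2) (use f(2) in auto)
  have R1: "R N \<le> c * q ^ N" for N
  proof -
    have "R N \<le> integral {0..a} (\<lambda>t. f t * exp t * q ^ N)"
      unfolding R_def
    proof (rule integral_le[OF int2])
      show "(\<lambda>t. f t * exp t * q ^ N) integrable_on {0..a}"
        using c' by (intro integrable_on_mult_left) auto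
      fix t assume t: "t \<in> {0..a}"
      show "f t * exp t * (1 - exp (- t)) ^ N \<le> f t * exp t * q ^ N"
        using t f(2)[OF t] by (intro mult_left_mono power_mono) (auto simp: q_def)
    qed
    then show ?thesis using c'(2) by simp
  qed
  have "(\<lambda>N. c * q ^ N) \<longlonglongrightarrow> c * 0"
    using q by (intro tendsto_intros LIMSEQ_realpow_zero)
  then have "(\<lambda>N. c * q ^ N) \<longlonglongrightarrow> 0" by simp
  from tendsto_sandwich[OF _ _ tendsto_const this] R0 R1 have "R \<longlonglongrightarrow> 0"
    by (auto intro: always_eventually)
  then have "(\<lambda>N. c - R N) \<longlonglongrightarrow> c - 0" by (intro tendsto_intros)
  then show ?thesis unfolding sums_def part by simp
qed

lemma pmf_embed_pmf_nat:
  fixes p :: "nat \<Rightarrow> real"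
  assumes "\<And>k. 0 \<le> p k" and "(\<lambda>k. p (Suc k)) sums (1 - p 0)"
  shows "pmf (embed_pmf p) k = p k"
proof (rule pmf_embed_pmf)
  have "p sums 1" using assms(2) by (simp add: sums_Suc_iff)
  then have "(\<Sum>k. ennreal (p k)) = ennreal 1"
    using assms(1) by (intro suminf_ennreal_eq) auto
  then show "(\<integral>\<^sup>+k. ennreal (p k) \<partial>count_space UNIV) = 1"
    by (simp add: nn_integral_count_space_nat)
qed (rule assms)

lemma pmf_D_U:
  assumes "0 \<le> \<alpha>" "\<alpha> \<le> 1"
  shows "pmf (D_U \<alpha>) k = p_U \<alpha> k"
  unfolding D_U_def
proof (rule pmf_embed_pmf_nat)
  show "0 \<le> p_U \<alpha> k" for k
    unfolding p_U_def using assms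
    by (auto intro!: integral_nonneg integrable_continuous_real continuous_intros)
  have "((\<lambda>t. (1 - \<alpha> + t) * exp t) has_integral
      (\<alpha> - \<alpha>) * exp \<alpha> - (0 - \<alpha>) * exp 0) {0..\<alpha>}"
    using assms
    by (intro fundamental_theorem_of_calculus[where f = "\<lambda>t. (t - \<alpha>) * exp t"])
      (auto intro!: derivative_eq_intros simp: algebra_simps
        simp flip: has_real_derivative_iff_has_vector_derivative)
  then have "((\<lambda>t. (1 - \<alpha> + t) * exp t) has_integral \<alpha>) {0..\<alpha>}" by simp
  from this assms
  have "(\<lambda>k. integral {0..\<alpha>} (\<lambda>t. (1 - \<alpha> + t) * (1 - exp (- t)) ^ k)) sums \<alpha>"
    by (intro geometric_mixture_sums continuous_intros) auto
  then show "(\<lambda>k. p_U \<alpha> (Suc k)) sums (1 - p_U \<alpha> 0)"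
    by (simp add: p_U_def)
qed

lemma pmf_D_L:
  assumes "0 \<le> \<alpha>" "\<alpha> \<le> 1"
  shows "pmf (D_L \<alpha>) k = p_L \<alpha> k"
  unfolding D_L_def
proof (rule pmf_embed_pmf_nat)
  have nn: "0 \<le> \<alpha> - t - (\<alpha> - t)\<^sup>2 / 2" if "t \<in> {0..\<alpha>}" for t
  proof -
    have "(\<alpha> - t) * (\<alpha> - t) \<le> (\<alpha> - t) * 1"
      using that assms by (intro mult_left_mono) auto
    then show ?thesis using that by (auto simp: power2_eq_square)
  qed
  show "0 \<le> p_L \<alpha> k" for k
    unfolding p_L_def using assms nn
    by (auto intro!: divide_nonneg_nonneg integral_nonneg integrable_continuous_real
        continuous_intros)
  have "((\<lambda>t. (\<alpha> - t - (\<alpha> - t)\<^sup>2 / 2) * exp t) has_integral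
      (- (\<alpha> - \<alpha>)\<^sup>2 / 2 * exp \<alpha>) - (- (\<alpha> - 0)\<^sup>2 / 2 * exp 0)) {0..\<alpha>}"
    using assms
    by (intro fundamental_theorem_of_calculus[where f = "\<lambda>t. - (\<alpha> - t)\<^sup>2 / 2 * exp t"])
      (auto intro!: derivative_eq_intros simp: field_simps power2_eq_square
        simp flip: has_real_derivative_iff_has_vector_derivative)
  then have "((\<lambda>t. (\<alpha> - t - (\<alpha> - t)\<^sup>2 / 2) * exp t) has_integral \<alpha>\<^sup>2 / 2) {0..\<alpha>}" by simp
  from this assms nn
  have "(\<lambda>k. integral {0..\<alpha>} (\<lambda>t. (\<alpha> - t - (\<alpha> - t)\<^sup>2 / 2) * (1 - exp (- t)) ^ k)) sums (\<alpha>\<^sup>2 / 2)"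
    by (intro geometric_mixture_sums continuous_intros) auto
  from sums_mult[OF this, of "1 / \<alpha>"]
  show "(\<lambda>k. p_L \<alpha> (Suc k)) sums (1 - p_L \<alpha> 0)"
    by (cases "\<alpha> = 0") (auto simp: p_L_def power2_eq_square)
qed

lemma pmf_D_E:
  assumes "0 \<le> \<alpha>" "\<alpha> \<le> 1"
  shows "pmf (D_E \<alpha>) k = p_E \<alpha> k"
  unfolding D_E_def
proof (rule pmf_embed_pmf_nat)
  show "0 \<le> p_E \<alpha> k" for k
    unfolding p_E_def using assms
    by (auto intro!: divide_nonneg_nonneg integral_nonneg integrable_continuous_real
        continuous_intros)
  have "((\<lambda>t. (\<alpha> - t) * exp (- t) * exp t) has_integral
      (- (\<alpha> - \<alpha>)\<^sup>2 / 2) - (- (\<alpha> - 0)\<^sup>2 / 2)) {0..\<alpha>}"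
    using assms
    by (intro fundamental_theorem_of_calculus[where f = "\<lambda>t. - (\<alpha> - t)\<^sup>2 / 2"])
      (auto intro!: derivative_eq_intros simp: field_simps exp_minus
        simp flip: has_real_derivative_iff_has_vector_derivative)
  then have "((\<lambda>t. (\<alpha> - t) * exp (- t) * exp t) has_integral \<alpha>\<^sup>2 / 2) {0..\<alpha>}" by simp
  from this assms
  have "(\<lambda>k. integral {0..\<alpha>} (\<lambda>t. (\<alpha> - t) * exp (- t) * (1 - exp (- t)) ^ k)) sums (\<alpha>\<^sup>2 / 2)"
    by (intro geometric_mixture_sums continuous_intros) auto
  from sums_mult[OF this, of "1 / \<alpha>"]
  show "(\<lambda>k. p_E \<alpha> (Suc k)) sums (1 - p_E \<alpha> 0)"
    by (cases "\<alpha> = 0") (auto simp: p_E_def power2_eq_square)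
qed

section \<open>Expressions interpreted as a limit at 0\<close>

text \<open>
  \<open>v\<close> is the value at \<open>\<alpha> \<ge> 0\<close> of the expression \<open>F\<close>, which for \<open>\<alpha> = 0\<close> is understood as
  the limit of \<open>F x\<close> as \<open>x \<rightarrow> 0\<close>.
\<close>

definition has_value_at :: "(real \<Rightarrow> real) \<Rightarrow> real \<Rightarrow> real \<Rightarrow> bool" where
  "has_value_at F \<alpha> v \<longleftrightarrow> (if \<alpha> = 0 then (F \<longlongrightarrow> v) (at_right 0) else v = F \<alpha>)"

end

theory Submission
  imports Defs "HOL-Library.Sublist" "HOL-Real_Asymp.Real_Asymp"
begin

text \<open>
  For \<open>G d = d\<close> and \<open>G d = d (d + 1)\<close>, which satisfy \<open>d (G (d + 1) - G d) = k G d\<close> with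
  \<open>k = 1\<close> and \<open>k = 2\<close>, the conditional expectation of \<open>\<Sum>\<^sub>j G (d\<^sub>j\<^sup>U)\<close> after an insertion is an
  affine function of its previous value, and so is that of \<open>\<Sum>\<^sub>i G (d\<^sub>i\<^sup>E)\<close>, because a displacement \<open>d\<close>
  increases with probability exactly \<open>d / m\<close>. Solving these linear recurrences gives the first two
  factorial moments exactly, in terms of \<open>n / m\<close> and \<open>(1 + K / m)\<^sup>n\<close>. Late displacements are never
  altered, so \<open>d\<^sub>i\<^sup>L\<close> is the cost of an unsuccessful search from \<open>h\<^sub>i\<close> at the time of insertion
  and its moments are averages of those of \<open>d\<^sup>U\<close>. The limits are then compared with the moments of the
  limit laws, which are mixtures of geometric distributions.
\<close>

section \<open>Walks along the links\<close>

text \<open>The definitions measure a table by \<open>LEAST\<close> over iterated links, a form in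
  which the effect of an insertion is hard to trace. A walk, the list of cells from a given cell
  down to a null link, turns a search cost into a length, a displacement into a position, and an
  insertion into an append or a splice; averaging over the next address becomes counting cells in
  walks. The functions d and d (d + 1) are rising factorials, eigenfunctions of d times the forward
  difference with the degree as eigenvalue; d^2 itself would bring the mean into its recurrence.
  Search costs grow at rate k + 1 instead of k because the new cell also carries a cost: hence the
  exponents 2 and 3 for \<open>d_unsuccessful\<close>, but 1 and 2 for early displacements.
  Convergence in law is not enough for variances and is bypassed: exact moments converge, and d^2 =
  d (d + 1) - d recovers the variance. The delicate case is \<alpha> = 0, where m / n is unbounded
  and the limit formulas divide by \<alpha>; the continuous function \<open>exprel\<close> absorbs
  both quotients.\<close>

fun walk :: "table \<Rightarrow> nat list \<Rightarrow> bool" where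
  "walk T [] = False"
| "walk T [c] = (link T c = None)"
| "walk T (c # d # xs) = (link T c = Some d \<and> walk T (d # xs))"

lemma walk_nonempty: "walk T xs \<Longrightarrow> xs \<noteq> []"
  by auto

lemma walk_Cons: "walk T (c # xs) \<longleftrightarrow> (if xs = [] then link T c = None else link T c = Some (hd xs) \<and> walk T xs)"
  by (cases xs) auto

lemma walk_suffix: "walk T (ys @ x # zs) \<Longrightarrow> walk T (x # zs)"
  by (induction ys) (auto simp: walk_Cons split: if_splits)

lemma walk_unique: "walk T xs \<Longrightarrow> walk T ys \<Longrightarrow> hd xs = hd ys \<Longrightarrow> xs = ys"
proof (induction xs arbitrary: ys)
  case (Cons c xs)
  obtain ys' where ys: "ys = c # ys'" using Cons.prems by (cases ys) auto
  show ?case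
    using Cons.prems Cons.IH[of ys'] unfolding ys by (auto simp: walk_Cons split: if_splits)
qed auto

text \<open>A repeated cell would start two walks, one a proper suffix of the other, and uniqueness
  would make them equal. So the mere existence of a walk excludes a cycle.\<close>

lemma walk_distinct: "walk T xs \<Longrightarrow> distinct xs"
proof (induction xs)
  case (Cons c xs)
  have "c \<notin> set xs"
  proof
    assume "c \<in> set xs"
    then obtain ys zs where xs: "xs = ys @ c # zs" by (meson split_list)
    have "walk T (c # zs)" using walk_suffix[of T "c # ys" c zs] Cons.prems by (simp add: xs)
    from walk_unique[OF this Cons.prems] show False by (simp add: xs)
  qed
  then show ?case using Cons by (auto simp: walk_Cons split: if_splits)
qed auto

lemma walk_cong: "(\<And>c. c \<in> set xs \<Longrightarrow> link T' c = link T c) \<Longrightarrow> walk T' xs = walk T xs"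
  by (induction xs) (auto simp: walk_Cons)

text \<open>Splicing principle for both policies: when the links strictly before \<open>x\<close>
  survive, only the part from \<open>x\<close> on has to be checked again.\<close>

lemma walk_replace_suffix:
  "walk T (ys @ x # zs) \<Longrightarrow> (\<And>y. y \<in> set ys \<Longrightarrow> link T' y = link T y) \<Longrightarrow> walk T' (x # ws)
    \<Longrightarrow> walk T' (ys @ x # ws)"
proof (induction ys)
  case (Cons y ys)
  then show ?case by (cases ys) (auto simp: walk_Cons)
qed auto

lemma link_last_walk: "walk T xs \<Longrightarrow> link T (last xs) = None"
  by (induction xs) (auto simp: walk_Cons split: if_splits)

lemma last_walk_suffix:
  "walk T xs \<Longrightarrow> link T e = None \<Longrightarrow> e \<in> set xs \<Longrightarrow> last xs = e"
  by (induction xs) (auto simp: walk_Cons split: if_splits)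

text \<open>Read backwards from the common end: injective links leave one choice of predecessor at
  each step, so the two walks agree until the shorter one is exhausted.\<close>

lemma walk_suffix_linear:
  assumes inj: "\<And>a b c. link T a = Some c \<Longrightarrow> link T b = Some c \<Longrightarrow> a = b"
  shows "walk T xs \<Longrightarrow> walk T ys \<Longrightarrow> last xs = last ys \<Longrightarrow> suffix xs ys \<or> suffix ys xs"
proof (induction xs)
  case (Cons a xs)
  show ?case
  proof (cases "xs = []")
    case True
    then have "ys = butlast ys @ [a]"
      using Cons.prems walk_nonempty[OF Cons.prems(2)] by (metis append_butlast_last_id last.simps)
    then show ?thesis using True by (metis suffixI)
  next
    case False
    then have a: "link T a = Some (hd xs)" "walk T xs" "last xs = last ys"
      using Cons.prems by (auto simp: walk_Cons)
    from Cons.IH[OF this(2) Cons.prems(2) this(3)] show ?thesis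
    proof
      assume "suffix xs ys"
      then obtain zs where zs: "ys = zs @ xs" by (auto elim: suffixE)
      show ?thesis
      proof (cases zs rule: rev_exhaust)
        case Nil
        then show ?thesis using zs by (simp add: suffix_ConsI)
      next
        case (snoc us z)
        have "walk T (z # xs)" using walk_suffix[of T us z xs] Cons.prems(2) by (simp add: zs snoc)
        then have "link T z = Some (hd xs)" using False by (simp add: walk_Cons)
        from inj[OF a(1) this] show ?thesis using zs snoc by (auto simp: suffix_def)
      qed
    qed (auto simp: suffix_ConsI)
  qed
qed auto

lemma follow_0: "follow T 0 c = Some c"
  by (simp add: follow_def)

lemma follow_Suc: "follow T (Suc r) c = (case link T c of None \<Rightarrow> None | Some d \<Rightarrow> follow T r d)"
proof -
  have "((\<lambda>x. Option.bind x (link T)) ^^ r) None = None" by (induction r) auto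
  then show ?thesis
    unfolding follow_def funpow_Suc_right by (auto split: option.split)
qed

lemma follow_walk:
  "walk T xs \<Longrightarrow> follow T r (hd xs) = (if r < length xs then Some (xs ! r) else None)"
proof (induction xs arbitrary: r)
  case (Cons c xs)
  then show ?case
    by (cases r) (auto simp: follow_0 follow_Suc walk_Cons split: if_splits)
qed auto

lemma cells_after_walk: "walk T xs \<Longrightarrow> Suc (cells_after T (hd xs)) = length xs"
proof -
  assume w: "walk T xs"
  have "(LEAST r. length xs \<le> Suc r) = length xs - 1" by (rule Least_equality) auto
  then show ?thesis
    using walk_nonempty[OF w] by (simp add: cells_after_def follow_walk[OF w] not_less)
qed

lemma chain_end_walk: "walk T xs \<Longrightarrow> chain_end T (hd xs) = last xs"
  using walk_nonempty[of T xs] cells_after_walk[of T xs]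
  by (auto simp: chain_end_def follow_walk last_conv_nth dest: sym)

section \<open>The invariant of a hash table\<close>

definition occupied :: "table \<Rightarrow> nat set" where
  "occupied T = {c. item T c \<noteq> None}"

definition search_cost :: "table \<Rightarrow> nat \<Rightarrow> nat" where
  "search_cost T c = (if item T c = None then 0 else 1 + cells_after T c)"

text \<open>The description is legitimate because a head determines its walk; the invariant below
  supplies existence at occupied cells.\<close>

definition walk_from :: "table \<Rightarrow> nat \<Rightarrow> nat list" where
  "walk_from T c = (THE xs. walk T xs \<and> hd xs = c)"

lemma walk_from_eq: "walk T xs \<Longrightarrow> walk_from T (hd xs) = xs"
  unfolding walk_from_def by (rule the_equality) (auto intro: walk_unique)

text \<open>The bound on item numbers makes the next item fresh, injectivity of \<open>item\<close>
  makes displacements well defined, and null links at empty cells let a new cell start detached.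
  Injective links make chains linear, so that walks with a common end are comparable.\<close>

definition valid_table :: "nat \<Rightarrow> nat \<Rightarrow> table \<Rightarrow> bool" where
  "valid_table m n T \<longleftrightarrow>
     occupied T \<subseteq> {1..m} \<and> card (occupied T) = n \<and>
     (\<forall>c i. item T c = Some i \<longrightarrow> i \<le> n) \<and>
     (\<forall>c d i. item T c = Some i \<longrightarrow> item T d = Some i \<longrightarrow> c = d) \<and>
     (\<forall>c. c \<notin> occupied T \<longrightarrow> link T c = None) \<and>
     (\<forall>a b c. link T a = Some c \<longrightarrow> link T b = Some c \<longrightarrow> a = b) \<and>
     (\<forall>c \<in> occupied T. \<exists>xs. walk T xs \<and> hd xs = c \<and> set xs \<subseteq> occupied T)"

lemma valid_tableD:
  assumes "valid_table m n T"
  shows "occupied T \<subseteq> {1..m}" "card (occupied T) = n" "finite (occupied T)"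
    "item T c = Some i \<Longrightarrow> i \<le> n"
    "item T c = Some i \<Longrightarrow> item T d = Some i \<Longrightarrow> c = d"
    "c \<notin> occupied T \<Longrightarrow> link T c = None"
    "link T a = Some c \<Longrightarrow> link T b = Some c \<Longrightarrow> a = b"
proof -
  note v = assms[unfolded valid_table_def]
  show "occupied T \<subseteq> {1..m}" using v by (elim conjE)
  then show "finite (occupied T)" using finite_subset by blast
  show "card (occupied T) = n" using v by (elim conjE)
  show "item T c = Some i \<Longrightarrow> i \<le> n" using v by (elim conjE) metis
  show "item T c = Some i \<Longrightarrow> item T d = Some i \<Longrightarrow> c = d" using v by (elim conjE) metis
  show "c \<notin> occupied T \<Longrightarrow> link T c = None" using v by (elim conjE) metis
  show "link T a = Some c \<Longrightarrow> link T b = Some c \<Longrightarrow> a = b" using v by (elim conjE) metis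
qed

lemma valid_table_walk:
  assumes "valid_table m n T" "c \<in> occupied T"
  shows "walk T (walk_from T c)" "hd (walk_from T c) = c" "set (walk_from T c) \<subseteq> occupied T"
    "c \<in> set (walk_from T c)" "length (walk_from T c) = search_cost T c"
    "distinct (walk_from T c)" "chain_end T c = last (walk_from T c)"
proof -
  obtain xs where xs: "walk T xs" "hd xs = c" "set xs \<subseteq> occupied T"
    using assms unfolding valid_table_def by (elim conjE) metis
  have "walk_from T c = xs" using walk_from_eq[OF xs(1)] xs(2) by simp
  then show "walk T (walk_from T c)" "hd (walk_from T c) = c" "set (walk_from T c) \<subseteq> occupied T"
    "c \<in> set (walk_from T c)" "length (walk_from T c) = search_cost T c"
    "distinct (walk_from T c)" "chain_end T c = last (walk_from T c)"
    using xs hd_in_set[OF walk_nonempty[OF xs(1)]] cells_after_walk[OF xs(1)] walk_distinct[OF xs(1)]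
      chain_end_walk[OF xs(1)] assms(2)
    by (auto simp: search_cost_def occupied_def)
qed

lemma valid_table_empty: "valid_table m 0 empty_table"
  by (simp add: valid_table_def empty_table_def occupied_def)

section \<open>Inserting an item\<close>

definition target_cell :: "nat \<Rightarrow> nat \<Rightarrow> table \<Rightarrow> nat" where
  "target_cell m a T = (if a \<in> occupied T then last_empty_cell m T else a)"

lemma target_cell:
  assumes "valid_table m n T" "n < m" "a \<in> {1..m}"
  shows "target_cell m a T \<in> {1..m}" "target_cell m a T \<notin> occupied T"
proof -
  \<comment> \<open>\<open>Max\<close> is informative only on a nonempty set; with
    \<open>n < m\<close> some cell is empty.\<close>
  have "\<not> {1..m} \<subseteq> occupied T"
    using card_mono[OF valid_tableD(3)[OF assms(1)], of "{1..m}"] valid_tableD(2)[OF assms(1)] assms(2)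
    by auto
  then have "{c \<in> {1..m}. item T c = None} \<noteq> {}" by (auto simp: occupied_def)
  from Max_in[OF _ this] have "last_empty_cell m T \<in> {c \<in> {1..m}. item T c = None}"
    by (simp add: last_empty_cell_def)
  then show "target_cell m a T \<in> {1..m}" "target_cell m a T \<notin> occupied T"
    using assms(3) by (auto simp: target_cell_def occupied_def)
qed

lemma item_insert_item: "item (insert_item \<Xi> m i a T) = (item T)(target_cell m a T := Some i)"
  by (auto simp: target_cell_def occupied_def Let_def)

lemma occupied_insert_item:
  "occupied (insert_item \<Xi> m i a T) = insert (target_cell m a T) (occupied T)"
  by (auto simp: occupied_def item_insert_item simp del: insert_item.simps)

lemma link_insert_item:
  "link (insert_item \<Xi> m i a T) =
    (if a \<notin> occupied T then link T
     else case \<Xi> of Late \<Rightarrow> (link T)(chain_end T a := Some (target_cell m a T))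
       | Early \<Rightarrow> (link T)(target_cell m a T := link T a, a := Some (target_cell m a T)))"
  by (auto simp: target_cell_def occupied_def Let_def split: policy.split)

declare insert_item.simps [simp del]

context
  fixes m n :: nat and T :: table and a i :: nat and j :: nat
  assumes T: "valid_table m n T" and nm: "n < m" and a: "a \<in> {1..m}"
  defines "j \<equiv> target_cell m a T"
begin

private lemma j: "j \<in> {1..m}" "j \<notin> occupied T" "link T j = None"
  using target_cell[OF T nm a] valid_tableD(6)[OF T] by (auto simp: j_def)

lemma walk_insert_unoccupied:
  assumes "a \<notin> occupied T"
  shows "c \<in> occupied T \<Longrightarrow> walk (insert_item \<Xi> m i a T) (walk_from T c)"
    and "walk (insert_item \<Xi> m i a T) [a]"
  using assms valid_table_walk(1)[OF T, of c] valid_tableD(6)[OF T]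
    walk_cong[of "walk_from T c" "insert_item \<Xi> m i a T" T]
  by (auto simp: link_insert_item)

text \<open>The only altered link is the null link at the end of the chain of \<open>a\<close>. A
  walk meets a null link only in its last cell, so walks with another end never see the
  change.\<close>

lemma walk_insert_Late:
  assumes a': "a \<in> occupied T"
  shows "c \<in> occupied T \<Longrightarrow> last (walk_from T c) \<noteq> last (walk_from T a) \<Longrightarrow>
      walk (insert_item Late m i a T) (walk_from T c)"
    and "c \<in> occupied T \<Longrightarrow> last (walk_from T c) = last (walk_from T a) \<Longrightarrow>
      walk (insert_item Late m i a T) (walk_from T c @ [j])"
    and "walk (insert_item Late m i a T) [j]"
proof -
  let ?T = "insert_item Late m i a T"
  let ?e = "last (walk_from T a)"
  note wa = valid_table_walk[OF T a']
  have e: "link T ?e = None" "?e \<in> occupied T"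
    using link_last_walk[OF wa(1)] wa(3) last_in_set[OF walk_nonempty[OF wa(1)]] by auto
  have l: "link ?T = (link T)(?e := Some j)"
    using a' wa(7) by (simp add: link_insert_item j_def)
  show "walk ?T [j]" using e j by (auto simp: l)
  {
    assume c: "c \<in> occupied T" and ne: "last (walk_from T c) \<noteq> ?e"
    note wc = valid_table_walk[OF T c]
    have "?e \<notin> set (walk_from T c)"
      using last_walk_suffix[OF wc(1) e(1)] ne by blast
    then show "walk ?T (walk_from T c)"
      using wc(1) by (subst walk_cong[of _ ?T T]) (auto simp: l)
  }
  {
    assume c: "c \<in> occupied T" and eq: "last (walk_from T c) = ?e"
    note wc = valid_table_walk[OF T c]
    define ys where "ys = butlast (walk_from T c)"
    have ys: "walk_from T c = ys @ [?e]"
      using eq walk_nonempty[OF wc(1)] by (simp add: ys_def flip: eq)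
    have "?e \<noteq> j" using e j by auto
    have "walk ?T (ys @ ?e # [j])"
    proof (rule walk_replace_suffix)
      show "walk T (ys @ ?e # [])" using wc(1) by (simp add: ys)
      show "link ?T y = link T y" if "y \<in> set ys" for y
        using that wc(6) by (auto simp: ys l)
      show "walk ?T (?e # [j])" using \<open>?e \<noteq> j\<close> j by (auto simp: l)
    qed
    then show "walk ?T (walk_from T c @ [j])" by (simp add: ys)
  }
qed

text \<open>The altered links are those of \<open>a\<close> and of the new cell, and no old walk
  contains the new cell. So a walk changes only where it passes \<open>a\<close>, which happens at
  most once.\<close>

lemma walk_insert_Early:
  assumes a': "a \<in> occupied T"
  shows "c \<in> occupied T \<Longrightarrow> a \<notin> set (walk_from T c) \<Longrightarrow>
      walk (insert_item Early m i a T) (walk_from T c)"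
    and "c \<in> occupied T \<Longrightarrow> walk_from T c = ys @ a # zs \<Longrightarrow>
      walk (insert_item Early m i a T) (ys @ a # j # zs)"
    and "walk (insert_item Early m i a T) (j # tl (walk_from T a))"
proof -
  let ?T = "insert_item Early m i a T"
  have l: "link ?T = (link T)(j := link T a, a := Some j)"
    using a' by (simp add: link_insert_item j_def)
  have aj: "a \<noteq> j" using a' j by auto
  \<comment> \<open>The new cell inherits the old link of \<open>a\<close> and so continues with
    what followed \<open>a\<close>; that tail contains neither \<open>a\<close> nor
    \<open>j\<close>, hence its links are intact.\<close>
  have *: "walk ?T (j # zs)" if "walk T (a # zs)" "j \<notin> set zs" for zs
  proof -
    have "a \<notin> set zs" using walk_distinct[OF that(1)] by simp
    then have "walk ?T zs = walk T zs"
      using that(2) by (intro walk_cong) (auto simp: l)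
    then show ?thesis using that aj by (auto simp: walk_Cons l split: if_splits)
  qed
  {
    assume c: "c \<in> occupied T" and ne: "a \<notin> set (walk_from T c)"
    note wc = valid_table_walk[OF T c]
    have "j \<notin> set (walk_from T c)" using wc(3) j by blast
    then show "walk ?T (walk_from T c)"
      using wc(1) ne by (subst walk_cong[of _ ?T T]) (auto simp: l)
  }
  {
    assume c: "c \<in> occupied T" and eq: "walk_from T c = ys @ a # zs"
    note wc = valid_table_walk[OF T c]
    have jn: "j \<notin> set (ys @ a # zs)" using wc(3) j eq by auto
    show "walk ?T (ys @ a # j # zs)"
    proof (rule walk_replace_suffix)
      show "walk T (ys @ a # zs)" using wc(1) by (simp add: eq)
      show "link ?T y = link T y" if "y \<in> set ys" for y
        using that wc(6) jn by (auto simp: eq l)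
      have "walk T (a # zs)" using wc(1) walk_suffix unfolding eq by blast
      from *[OF this] jn show "walk ?T (a # j # zs)" by (auto simp: l)
    qed
  }
  note wa = valid_table_walk[OF T a']
  have "walk_from T a = a # tl (walk_from T a)"
    using wa(2) walk_nonempty[OF wa(1)] by (metis list.collapse)
  then show "walk ?T (j # tl (walk_from T a))"
    using wa(1,3) j *[of "tl (walk_from T a)"] by (metis list.set_intros(2) subsetD)
qed

end

text \<open>Its main use is the contrapositive: no link points to an empty cell, so the cell being
  filled has no predecessor yet.\<close>

lemma link_occupied:
  assumes "valid_table m n T" "link T b = Some c"
  shows "b \<in> occupied T" "c \<in> occupied T"
proof -
  show b: "b \<in> occupied T" using valid_tableD(6)[OF assms(1), of b] assms(2) by auto
  note w = valid_table_walk[OF assms(1) b]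
  obtain xs where xs: "walk_from T b = b # xs"
    using w(2) walk_nonempty[OF w(1)] by (cases "walk_from T b") auto
  with w(1) assms(2) have "xs \<noteq> []" "hd xs = c" by (auto simp: walk_Cons split: if_splits)
  with w(3) xs show "c \<in> occupied T" by (cases xs) auto
qed

lemma search_cost_walk:
  "walk T xs \<Longrightarrow> hd xs \<in> occupied T \<Longrightarrow> search_cost T (hd xs) = length xs"
  using cells_after_walk[of T xs] by (auto simp: search_cost_def occupied_def)

lemma walk_insert_new:
  assumes T: "valid_table m n T" and nm: "n < m" and a: "a \<in> {1..m}"
  defines "j \<equiv> target_cell m a T"
  shows "walk (insert_item \<Xi> m i a T) (j # (if \<Xi> = Early \<and> a \<in> occupied T then tl (walk_from T a) else []))"
proof (cases "a \<in> occupied T")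
  case True
  then show ?thesis
    using walk_insert_Late(3)[OF T nm a] walk_insert_Early(3)[OF T nm a]
    unfolding j_def by (cases \<Xi>) (auto simp del: walk.simps)
next
  case False
  then show ?thesis
    using walk_insert_unoccupied(2)[OF T nm a] by (auto simp: j_def target_cell_def)
qed

text \<open>Under early insertion into a chain, the new cell replaces \<open>a\<close> at the head
  of the old walk from \<open>a\<close>, so it costs what \<open>a\<close> cost before. In all other
  cases it ends its chain.\<close>

lemma search_cost_insert_new:
  assumes T: "valid_table m n T" and nm: "n < m" and a: "a \<in> {1..m}"
  shows "search_cost (insert_item \<Xi> m i a T) (target_cell m a T) =
    (if \<Xi> = Early \<and> a \<in> occupied T then search_cost T a else 1)"
  using search_cost_walk[OF walk_insert_new[OF T nm a, of \<Xi> i]]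
    valid_table_walk(5)[OF T, of a] valid_table_walk(1)[OF T, of a] walk_nonempty[of T "walk_from T a"]
  by (auto simp: occupied_insert_item split: if_splits) (metis Suc_pred length_greater_0_conv)

lemma walk_insert_Late':
  assumes T: "valid_table m n T" and nm: "n < m" and a: "a \<in> {1..m}" and c: "c \<in> occupied T"
  shows "walk (insert_item Late m i a T)
    (walk_from T c @ (if a \<in> occupied T \<and> last (walk_from T c) = last (walk_from T a)
      then [target_cell m a T] else []))"
  using walk_insert_Late(1,2)[OF T nm a _ c] walk_insert_unoccupied(1)[OF T nm a _ c]
  by (cases "a \<in> occupied T") (auto simp del: walk.simps)

lemma search_cost_insert_Late:
  assumes T: "valid_table m n T" and nm: "n < m" and a: "a \<in> {1..m}" and c: "c \<in> occupied T"
  shows "search_cost (insert_item Late m i a T) c = search_cost T c +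
    of_bool (a \<in> occupied T \<and> last (walk_from T c) = last (walk_from T a))"
proof -
  note w = valid_table_walk[OF T c]
  show ?thesis
    using search_cost_walk[OF walk_insert_Late'[OF T nm a c, of i]] w(2,5) walk_nonempty[OF w(1)] c
    by (auto simp: occupied_insert_item)
qed

lemma suffix_walk_from:
  assumes T: "valid_table m n T" and c: "c \<in> occupied T" and b: "b \<in> set (walk_from T c)"
  shows "suffix (walk_from T b) (walk_from T c)"
proof -
  obtain ys zs where s: "walk_from T c = ys @ b # zs" using b by (meson split_list)
  have "walk T (b # zs)" using valid_table_walk(1)[OF T c] walk_suffix unfolding s by blast
  from walk_from_eq[OF this] s show ?thesis by (simp add: suffix_def)
qed

text \<open>Walks with a common end are nested as suffixes. This trades the chain end, by which late
  insertion is described, for membership in walks, which can be counted.\<close>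

lemma same_end_iff:
  assumes T: "valid_table m n T" and a: "a \<in> occupied T" and c: "c \<in> occupied T"
  shows "last (walk_from T c) = last (walk_from T a) \<longleftrightarrow>
    a \<in> set (walk_from T c) \<or> c \<in> set (walk_from T a)"
proof -
  have *: "last (walk_from T c) = last (walk_from T b)"
    if "b \<in> set (walk_from T c)" "b \<in> occupied T" "c \<in> occupied T" for b c
    using suffix_walk_from[OF T that(3,1)] walk_nonempty[OF valid_table_walk(1)[OF T that(2)]]
    by (auto simp: suffix_def)
  have **: "c \<in> set (walk_from T a)" if "suffix (walk_from T c) (walk_from T a)" "c \<in> occupied T" for a c
    using set_mono_suffix[OF that(1)] valid_table_walk(4)[OF T that(2)] by auto
  show ?thesis
  proof
    assume "last (walk_from T c) = last (walk_from T a)"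
    then have "suffix (walk_from T c) (walk_from T a) \<or> suffix (walk_from T a) (walk_from T c)"
      using valid_tableD(7)[OF T] valid_table_walk(1)[OF T] a c by (intro walk_suffix_linear) auto
    then show "a \<in> set (walk_from T c) \<or> c \<in> set (walk_from T a)" using ** a c by blast
  qed (use *[of a c] *[of c a] a c in auto)
qed

lemma walk_insert_Early':
  assumes T: "valid_table m n T" and nm: "n < m" and a: "a \<in> {1..m}" and c: "c \<in> occupied T"
  shows "a \<notin> set (walk_from T c) \<Longrightarrow> walk (insert_item Early m i a T) (walk_from T c)"
    and "walk_from T c = ys @ a # zs \<Longrightarrow>
      walk (insert_item Early m i a T) (ys @ a # target_cell m a T # zs)"
proof -
  show "walk (insert_item Early m i a T) (walk_from T c)" if "a \<notin> set (walk_from T c)"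
    using walk_insert_Early(1)[OF T nm a _ c that] walk_insert_unoccupied(1)[OF T nm a _ c] by blast
  show "walk (insert_item Early m i a T) (ys @ a # target_cell m a T # zs)"
    if "walk_from T c = ys @ a # zs"
  proof -
    have "a \<in> occupied T" using valid_table_walk(3)[OF T c] that by auto
    from walk_insert_Early(2)[OF T nm a this c that] show ?thesis .
  qed
qed

lemma search_cost_insert_Early:
  assumes T: "valid_table m n T" and nm: "n < m" and a: "a \<in> {1..m}" and c: "c \<in> occupied T"
  shows "search_cost (insert_item Early m i a T) c = search_cost T c + of_bool (a \<in> set (walk_from T c))"
proof -
  note w = valid_table_walk[OF T c]
  have o: "c \<in> occupied (insert_item Early m i a T)" using c by (simp add: occupied_insert_item)
  show ?thesis
  proof (cases "a \<in> set (walk_from T c)")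
    case True
    then obtain ys zs where s: "walk_from T c = ys @ a # zs" by (meson split_list)
    have "hd (ys @ a # target_cell m a T # zs) = c" using w(2) by (cases ys) (auto simp: s)
    then show ?thesis
      using search_cost_walk[OF walk_insert_Early'(2)[OF T nm a c s, of i]] w(5) True o
      by (simp add: s)
  next
    case False
    then show ?thesis using search_cost_walk[OF walk_insert_Early'(1)[OF T nm a c False, of i]] w o
      by simp
  qed
qed

lemma valid_table_insert:
  assumes T: "valid_table m n T" and nm: "n < m" and a: "a \<in> {1..m}"
  shows "valid_table m (Suc n) (insert_item \<Xi> m (Suc n) a T)"
  unfolding valid_table_def
proof (intro conjI)
  let ?j = "target_cell m a T"
  let ?T = "insert_item \<Xi> m (Suc n) a T"
  note j = target_cell[OF T nm a]
  note D = valid_tableD[OF T]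
  have e: "link T (chain_end T a) = None" "chain_end T a \<in> occupied T" if "a \<in> occupied T"
  proof -
    note w = valid_table_walk[OF T that]
    show "link T (chain_end T a) = None" "chain_end T a \<in> occupied T"
      using link_last_walk[OF w(1)] w(3,7) last_in_set[OF walk_nonempty[OF w(1)]] by auto
  qed
  show "occupied ?T \<subseteq> {1..m}" using j D(1) by (auto simp: occupied_insert_item)
  show "card (occupied ?T) = Suc n" using j D(2,3) by (simp add: occupied_insert_item)
  show "\<forall>c i. item ?T c = Some i \<longrightarrow> i \<le> Suc n"
    using D(4) by (auto simp: item_insert_item le_SucI)
  have "item T c \<noteq> Some (Suc n)" for c using D(4)[of c "Suc n"] by auto
  then show "\<forall>c d i. item ?T c = Some i \<longrightarrow> item ?T d = Some i \<longrightarrow> c = d"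
    using D(5) by (auto simp: item_insert_item) 
  show "\<forall>c. c \<notin> occupied ?T \<longrightarrow> link ?T c = None"
    using D(6) e by (auto simp: occupied_insert_item link_insert_item split: policy.split)
  have lj: "link T b \<noteq> Some ?j" "link T ?j = None" for b
    using link_occupied[OF T] j(2) D(6) by blast+
  \<comment> \<open>The instances at \<open>a\<close> serve early insertion, where the new cell
    takes over the link of \<open>a\<close>. The link to the new cell duplicates none, because no
    link pointed there before (\<open>lj\<close>).\<close>
  have "a' = b" if "link ?T a' = Some c" "link ?T b = Some c" for a' b c
    using that D(7)[of a' c b] D(7)[of a' c a] D(7)[of a c b] lj
    by (auto simp: link_insert_item split: if_splits policy.splits)
  then show "\<forall>a b c. link ?T a = Some c \<longrightarrow> link ?T b = Some c \<longrightarrow> a = b" by blast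
  show "\<forall>c\<in>occupied ?T. \<exists>xs. walk ?T xs \<and> hd xs = c \<and> set xs \<subseteq> occupied ?T"
  proof
    fix c assume "c \<in> occupied ?T"
    then consider "c = ?j" | "c \<in> occupied T" by (auto simp: occupied_insert_item)
    then show "\<exists>xs. walk ?T xs \<and> hd xs = c \<and> set xs \<subseteq> occupied ?T"
    proof cases
      case 1
      have "set (tl (walk_from T a)) \<subseteq> occupied T" if "a \<in> occupied T"
        using valid_table_walk(3)[OF T that] list.set_sel(2)[of "walk_from T a"]
        by (cases "walk_from T a") auto
      then show ?thesis using 1
        by (intro exI[of _ "?j # (if \<Xi> = Early \<and> a \<in> occupied T then tl (walk_from T a) else [])"]
          conjI walk_insert_new[OF T nm a]) (auto simp: occupied_insert_item)
    next
      case 2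
      note w = valid_table_walk[OF T 2]
      show ?thesis
      proof (cases \<Xi>)
        case Late
        show ?thesis
          unfolding Late using walk_insert_Late'[OF T nm a 2] w(2,3) walk_nonempty[OF w(1)]
          by (intro exI[of _ "walk_from T c @ (if a \<in> occupied T \<and> last (walk_from T c) =
            last (walk_from T a) then [?j] else [])"] conjI) (auto simp: occupied_insert_item hd_append)
      next
        case Early
        show ?thesis
        proof (cases "a \<in> set (walk_from T c)")
          case True
          then obtain ys zs where s: "walk_from T c = ys @ a # zs" by (meson split_list)
          have "hd (ys @ a # ?j # zs) = c" using w(2) by (cases ys) (auto simp: s)
          then show ?thesis
            unfolding Early using walk_insert_Early'(2)[OF T nm a 2 s] w(3) s
            by (intro exI conjI) (auto simp: occupied_insert_item)
        next
          case False
          from walk_insert_Early'(1)[OF T nm a 2 False] w(2,3) show ?thesis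
            unfolding Early by (intro exI conjI) (auto simp: occupied_insert_item)
        qed
      qed
    qed
  qed
qed

lemma valid_hash_table:
  "n \<le> m \<Longrightarrow> (\<And>i. i \<in> {1..n} \<Longrightarrow> h i \<in> {1..m}) \<Longrightarrow> valid_table m n (hash_table \<Xi> m n h)"
proof (induction n)
  case (Suc n)
  then have "valid_table m n (hash_table \<Xi> m n h)" by simp
  with Suc.prems show ?case by (simp add: valid_table_insert)
qed (simp add: valid_table_empty)

text \<open>Down a walk the cost drops by one per cell and ends at 1, so every value is taken once.
  This is what lets differences of \<open>G\<close> telescope over a walk.\<close>

lemma sum_search_cost_walk:
  fixes F :: "nat \<Rightarrow> real"
  shows "walk T xs \<Longrightarrow> set xs \<subseteq> occupied T \<Longrightarrow>
    (\<Sum>c\<in>set xs. F (search_cost T c)) = (\<Sum>d=1..length xs. F d)"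
proof (induction xs)
  case (Cons x xs)
  have "search_cost T x = Suc (length xs)" using search_cost_walk[OF Cons.prems(1)] Cons.prems(2) by simp
  moreover have "x \<notin> set xs" using walk_distinct[OF Cons.prems(1)] by simp
  ultimately show ?case
    using Cons by (cases "xs = []") (auto simp: walk_Cons)
qed auto

lemma walk_from_antisym:
  assumes T: "valid_table m n T" and "a \<in> occupied T" "c \<in> occupied T"
    and "a \<in> set (walk_from T c)" "c \<in> set (walk_from T a)"
  shows "a = c"
proof -
  have "walk_from T a = walk_from T c"
    using suffix_walk_from[OF T] assms(2-5) by (intro suffix_order.antisym)
  then show ?thesis using valid_table_walk(2)[OF T] assms(2,3) by metis
qed

text \<open>
  Summing over the hash address \<open>a\<close> of the new item, each cell \<open>c\<close> gains one unit for every \<open>a\<close>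
  that affects it. Under early insertion these are the \<open>search_cost T c\<close> cells at or after \<open>c\<close>.
  Under late insertion the cells strictly before \<open>c\<close> also count; with the two cells
  interchanged, that contribution telescopes along the walk from \<open>a\<close>, which compensates for the new
  cell having cost 1 instead of \<open>search_cost T a\<close>.
\<close>

lemma sum_search_cost_insert:
  fixes G :: "nat \<Rightarrow> real" and i :: nat and \<Xi> :: policy
  assumes T: "valid_table m n T" and nm: "n < m"
    and G: "\<And>d. real d * (G (Suc d) - G d) = k * G d"
  defines "T' \<equiv> \<lambda>a. insert_item \<Xi> m i a T"
  shows "(\<Sum>a\<in>{1..m}. \<Sum>c\<in>occupied (T' a). G (search_cost (T' a) c)) =
    (real m + 1 + k) * (\<Sum>c\<in>occupied T. G (search_cost T c)) + (real m - real n) * G 1"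
proof -
  define X where "X = occupied T"
  define D where "D = search_cost T"
  define H where "H d = G (Suc d) - G d" for d
  define W where "W c = set (walk_from T c)" for c
  \<comment> \<open>\<open>P a c\<close> says that the address \<open>a\<close> raises the cost of
    the old cell \<open>c\<close> by one; \<open>N a\<close> is the cost of the new cell.\<close>
  define P where "P a c \<longleftrightarrow> (if \<Xi> = Early then a \<in> W c else a \<in> X \<and> (a \<in> W c \<or> c \<in> W a))" for a c
  define N where "N a = (if \<Xi> = Early \<and> a \<in> X then D a else 1)" for a
  note X = valid_tableD(1-3)[OF T, folded X_def]
  have W: "W c \<subseteq> X" "c \<in> W c" "card (W c) = D c" "finite (W c)" if "c \<in> X" for c
    using valid_table_walk[OF T that[unfolded X_def]]
    by (auto simp: W_def X_def D_def distinct_card)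
  have inner: "(\<Sum>c\<in>occupied (T' a). G (search_cost (T' a) c)) =
      (\<Sum>c\<in>X. G (D c)) + (\<Sum>c\<in>X. of_bool (P a c) * H (D c)) + G (N a)" if a: "a \<in> {1..m}" for a
  proof -
    have "search_cost (T' a) c = D c + of_bool (P a c)" if "c \<in> X" for c
      using search_cost_insert_Late[OF T nm a that[unfolded X_def], of i]
        search_cost_insert_Early[OF T nm a that[unfolded X_def], of i]
        same_end_iff[OF T _ that[unfolded X_def], of a]
      by (cases \<Xi>) (auto simp: P_def T'_def D_def W_def X_def)
    then have "(\<Sum>c\<in>X. G (search_cost (T' a) c)) = (\<Sum>c\<in>X. G (D c) + of_bool (P a c) * H (D c))"
      by (intro sum.cong) (auto simp: H_def)
    then show ?thesis
      using target_cell[OF T nm a] X search_cost_insert_new[OF T nm a, of \<Xi> i]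
      by (simp add: T'_def occupied_insert_item X_def N_def D_def sum.distrib)
  qed
  have "(\<Sum>a\<in>{1..m}. \<Sum>c\<in>occupied (T' a). G (search_cost (T' a) c)) =
      m * (\<Sum>c\<in>X. G (D c)) + (\<Sum>a\<in>{1..m}. \<Sum>c\<in>X. of_bool (P a c) * H (D c)) + (\<Sum>a\<in>{1..m}. G (N a))"
    by (simp add: inner sum.distrib)
  moreover have split: "(\<Sum>a\<in>{1..m}. F a) = (\<Sum>a\<in>X. F a) + (\<Sum>a\<in>{1..m} - X. F a)" for F :: "nat \<Rightarrow> real"
    using sum.subset_diff[OF X(1), of F] by simp
  have cardN: "real (card ({Suc 0..m} - X)) = real m - real n"
    using X nm by (simp add: card_Diff_subset of_nat_diff)
  \<comment> \<open>Exactly \<open>D c\<close> addresses lie on the walk from \<open>c\<close>, each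
    adding \<open>H (D c)\<close>; the hypothesis on \<open>G\<close> turns the product into
    \<open>k * G (D c)\<close>.\<close>
  have 1: "(\<Sum>a\<in>{1..m}. \<Sum>c\<in>X. of_bool (a \<in> W c) * H (D c)) = k * (\<Sum>c\<in>X. G (D c))"
  proof -
    have "(\<Sum>a\<in>{1..m}. of_bool (a \<in> W c)) = real (D c)" if "c \<in> X" for c
    proof -
      have "{Suc 0..m} \<inter> W c = W c" using W[OF that] X by auto
      then show ?thesis using W[OF that] by simp
    qed
    then have "(\<Sum>c\<in>X. \<Sum>a\<in>{1..m}. of_bool (a \<in> W c) * H (D c)) = (\<Sum>c\<in>X. k * G (D c))"
      by (intro sum.cong) (simp_all add: H_def G flip: sum_distrib_right)
    then show ?thesis by (subst sum.swap) (simp add: sum_distrib_left)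
  qed
  have "(\<Sum>a\<in>{1..m}. \<Sum>c\<in>X. of_bool (P a c) * H (D c)) + (\<Sum>a\<in>{1..m}. G (N a)) =
      (1 + k) * (\<Sum>c\<in>X. G (D c)) + (real m - real n) * G 1"
  proof (cases \<Xi>)
    case Early
    \<comment> \<open>Source of the summand 1 in the factor: at an occupied address the new cell
      repeats the cost \<open>D a\<close>, and at each of the \<open>m - n\<close> empty ones it
      costs 1.\<close>
    have "(\<Sum>a\<in>{1..m}. G (N a)) = (\<Sum>c\<in>X. G (D c)) + (real m - real n) * G 1"
      by (subst split) (simp add: N_def Early cardN)
    then show ?thesis using 1 by (simp add: P_def Early algebra_simps)
  next
    case Late
    \<comment> \<open>Inclusion and exclusion: each of \<open>a\<close> and \<open>c\<close> is at
      or after the other only if they coincide.\<close>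
    have b: "of_bool (P a c) = of_bool (a \<in> W c) + of_bool (a \<in> X \<and> c \<in> W a) - (of_bool (a = c) :: real)"
      if "c \<in> X" for a c
      using W[OF that] walk_from_antisym[OF T, of a c] that
      by (auto simp: P_def Late W_def X_def)
    have 2: "(\<Sum>a\<in>{1..m}. \<Sum>c\<in>X. of_bool (a \<in> X \<and> c \<in> W a) * H (D c)) = (\<Sum>a\<in>X. G (Suc (D a)) - G 1)"
    proof -
      have "(\<Sum>c\<in>X. of_bool (c \<in> W a) * H (D c)) = G (Suc (D a)) - G 1" if "a \<in> X" for a
      proof -
        note w = valid_table_walk[OF T that[unfolded X_def]]
        have "(\<Sum>c\<in>X. of_bool (c \<in> W a) * H (D c)) = (\<Sum>c\<in>W a. H (D c))"
          using W[OF that] X by (intro sum.mono_neutral_cong_right) auto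
        also have "\<dots> = (\<Sum>d=1..D a. H d)"
          using sum_search_cost_walk[OF w(1,3), of H] w(5) by (simp add: W_def D_def)
        also have "\<dots> = G (Suc (D a)) - G 1"
          unfolding H_def by (subst sum_Suc_diff) auto
        finally show ?thesis .
      qed
      then show ?thesis by (subst split) simp
    qed
    have 3: "(\<Sum>a\<in>{1..m}. \<Sum>c\<in>X. of_bool (a = c) * H (D c)) = (\<Sum>a\<in>X. H (D a))"
    proof -
      have "(\<Sum>c\<in>X. of_bool (a = c) * H (D c)) = (if a \<in> X then H (D a) else 0)" for a
        using X by (simp add: of_bool_def if_distrib[of "\<lambda>x. x * _"] cong: if_cong)
      then show ?thesis by (subst split) simp
    qed
    have "(\<Sum>a\<in>{1..m}. \<Sum>c\<in>X. of_bool (P a c) * H (D c)) =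
      k * (\<Sum>c\<in>X. G (D c)) + (\<Sum>a\<in>X. G (Suc (D a)) - G 1) - (\<Sum>a\<in>X. H (D a))"
      unfolding 1[symmetric] 2[symmetric] 3[symmetric]
      by (simp add: b ring_distribs sum.distrib sum_subtractf)
    \<comment> \<open>The terms \<open>G (Suc (D a))\<close> cancel, leaving one more copy of the
      old sum and \<open>- n * G 1\<close>. The new cells, all of cost 1, then contribute
      \<open>m * G 1\<close>.\<close>
    also have "\<dots> = (1 + k) * (\<Sum>c\<in>X. G (D c)) - n * G 1"
      using X by (simp add: H_def sum_subtractf algebra_simps)
    finally show ?thesis by (simp add: N_def Late algebra_simps)
  qed
  ultimately show ?thesis unfolding X_def D_def by (simp add: algebra_simps)
qed

section \<open>Displacements\<close>

text \<open>A position in a walk stands in for the \<open>LEAST\<close> of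
  \<open>displacement\<close>, so that it can be carried through an insertion.\<close>

definition located :: "table \<Rightarrow> nat \<Rightarrow> nat \<Rightarrow> nat \<Rightarrow> bool" where
  "located T a r i \<longleftrightarrow> a \<in> occupied T \<and> r < length (walk_from T a) \<and> item T (walk_from T a ! r) = Some i"

lemma locatedI:
  "walk T xs \<Longrightarrow> hd xs \<in> occupied T \<Longrightarrow> r < length xs \<Longrightarrow> item T (xs ! r) = Some i \<Longrightarrow>
    located T (hd xs) r i"
  by (simp add: located_def walk_from_eq)

text \<open>An item sits in one cell and a walk does not repeat cells, so the minimum is over a
  single position.\<close>

lemma located_unique:
  assumes T: "valid_table m n T" and l: "located T a r i"
  shows "(LEAST r. \<exists>c. follow T r a = Some c \<and> item T c = Some i) = r"
proof (rule Least_equality)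
  let ?xs = "walk_from T a"
  have a: "a \<in> occupied T" and r: "r < length ?xs" "item T (?xs ! r) = Some i"
    using l by (auto simp: located_def)
  note w = valid_table_walk[OF T a]
  have f: "follow T r a = (if r < length ?xs then Some (?xs ! r) else None)" for r
    using follow_walk[OF w(1)] w(2) by simp
  show "\<exists>c. follow T r a = Some c \<and> item T c = Some i" using r by (simp add: f)
  fix r' assume "\<exists>c. follow T r' a = Some c \<and> item T c = Some i"
  then have r': "r' < length ?xs" "item T (?xs ! r') = Some i" by (auto simp: f split: if_splits)
  from valid_tableD(5)[OF T r(2) r'(2)] r(1) r'(1) w(6) have "r = r'"
    by (simp add: nth_eq_iff_index_eq)
  then show "r \<le> r'" by simp
qed

lemma located_insert_Late:
  assumes T: "valid_table m n T" and nm: "n < m" and x: "x \<in> {1..m}" and l: "located T a r i"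
  shows "located (insert_item Late m k x T) a r i"
proof -
  have a: "a \<in> occupied T" and r: "r < length (walk_from T a)" "item T (walk_from T a ! r) = Some i"
    using l by (auto simp: located_def)
  note w = valid_table_walk[OF T a]
  have "walk_from T a ! r \<in> occupied T" using w(3) nth_mem[OF r(1)] by (rule subsetD)
  then have "walk_from T a ! r \<noteq> target_cell m x T"
    using target_cell(2)[OF T nm x] by auto
  with locatedI[OF walk_insert_Late'[OF T nm x a, of k], of r i] r w(2) walk_nonempty[OF w(1)] a
  show ?thesis
    by (auto simp: occupied_insert_item item_insert_item nth_append)
qed

text \<open>The new cell goes directly after \<open>x\<close>, so the item is pushed back only by
  the \<open>r\<close> cells strictly before its own; hence \<open>take r\<close>. An insertion at
  the item's own cell leaves it in place.\<close>

lemma located_insert_Early: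
  assumes T: "valid_table m n T" and nm: "n < m" and x: "x \<in> {1..m}" and l: "located T a r i"
  shows "located (insert_item Early m k x T) a (r + of_bool (x \<in> set (take r (walk_from T a)))) i"
proof -
  have a: "a \<in> occupied T" and r: "r < length (walk_from T a)" "item T (walk_from T a ! r) = Some i"
    using l by (auto simp: located_def)
  note w = valid_table_walk[OF T a]
  have "walk_from T a ! r \<in> occupied T" using w(3) nth_mem[OF r(1)] by (rule subsetD)
  then have ne: "walk_from T a ! r \<noteq> target_cell m x T"
    using target_cell(2)[OF T nm x] by auto
  show ?thesis
  proof (cases "x \<in> set (walk_from T a)")
    case False
    then have "x \<notin> set (take r (walk_from T a))" using in_set_takeD by fast
    with locatedI[OF walk_insert_Early'(1)[OF T nm x a False, of k], of r i] r w(2) a ne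
    show ?thesis by (auto simp: occupied_insert_item item_insert_item)
  next
    case True
    then obtain ys zs where s: "walk_from T a = ys @ x # zs" by (meson split_list)
    let ?ws = "ys @ x # target_cell m x T # zs"
    have hd: "hd ?ws = a" using w(2) by (cases ys) (auto simp: s)
    have d: "x \<notin> set ys" "x \<notin> set zs" using w(6) by (auto simp: s)
    have t: "x \<in> set (take r (walk_from T a)) \<longleftrightarrow> length ys < r"
      using d by (auto simp: s take_Cons' dest: in_set_takeD)
    let ?r = "r + of_bool (x \<in> set (take r (walk_from T a)))"
    have "?r < length ?ws" using r by (auto simp: s)
    moreover have "?ws ! ?r = walk_from T a ! r"
      unfolding t by (auto simp: s nth_append nth_Cons' Suc_diff_le)
    ultimately show ?thesis
      using locatedI[OF walk_insert_Early'(2)[OF T nm x a s, of k], of ?r i] r a ne hd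
      by (auto simp: occupied_insert_item item_insert_item)
  qed
qed

lemma located_insert_new:
  assumes T: "valid_table m n T" and nm: "n < m" and x: "x \<in> {1..m}"
  shows "located (insert_item \<Xi> m k x T) x
    (if x \<in> occupied T then case \<Xi> of Late \<Rightarrow> search_cost T x | Early \<Rightarrow> 1 else 0) k"
proof (cases "x \<in> occupied T")
  case False
  then show ?thesis
    using locatedI[OF walk_insert_unoccupied(2)[OF T nm x False, of \<Xi> k], of 0 k]
    by (simp add: occupied_insert_item item_insert_item target_cell_def)
next
  case True
  note w = valid_table_walk[OF T True]
  show ?thesis
  proof (cases \<Xi>)
    case Late
    have "walk (insert_item Late m k x T) (walk_from T x @ [target_cell m x T])"
      using walk_insert_Late'[OF T nm x True, of k] True by simp
    from locatedI[OF this, of "search_cost T x" k] show ?thesis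
      using w(2,5) walk_nonempty[OF w(1)] True
      by (simp add: Late occupied_insert_item item_insert_item nth_append)
  next
    case Early
    obtain zs where "walk_from T x = [] @ x # zs"
      using w(2) walk_nonempty[OF w(1)] by (cases "walk_from T x") auto
    from locatedI[OF walk_insert_Early'(2)[OF T nm x True this, of k], of 1 k] show ?thesis
      using True by (simp add: Early occupied_insert_item item_insert_item)
  qed
qed

lemma hash_table_cong:
  "(\<And>i. i \<in> {1..n} \<Longrightarrow> h i = h' i) \<Longrightarrow> hash_table \<Xi> m n h = hash_table \<Xi> m n h'"
  by (induction n) auto

lemma displacement_located:
  assumes "n \<le> m" "\<And>i. i \<in> {1..n} \<Longrightarrow> h i \<in> {1..m}" "located (hash_table \<Xi> m n h) (h i) r i"
  shows "displacement \<Xi> m n h i = r"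
  using located_unique[OF valid_hash_table[OF assms(1,2)] assms(3)] by (simp add: displacement_def)

lemma located_displacement:
  assumes "n \<le> m" "\<And>i. i \<in> {1..n} \<Longrightarrow> h i \<in> {1..m}" "i \<in> {1..n}"
  shows "located (hash_table \<Xi> m n h) (h i) (displacement \<Xi> m n h i) i"
proof -
  have "\<exists>r. located (hash_table \<Xi> m n h) (h i) r i"
    using assms
  proof (induction n)
    case (Suc n)
    have T: "valid_table m n (hash_table \<Xi> m n h)" using Suc.prems by (intro valid_hash_table) auto
    have nm: "n < m" and x: "h (Suc n) \<in> {1..m}" using Suc.prems by auto
    show ?case
    proof (cases "i = Suc n")
      case True
      then show ?thesis using located_insert_new[OF T nm x, of \<Xi> "Suc n"] by auto
    next
      case False
      then have "i \<in> {1..n}" using Suc.prems(3) by simp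
      with Suc.IH Suc.prems(1,2) have "\<exists>r. located (hash_table \<Xi> m n h) (h i) r i" by simp
      then obtain r where r: "located (hash_table \<Xi> m n h) (h i) r i" ..
      have "\<exists>r. located (insert_item \<Xi> m (Suc n) (h (Suc n)) (hash_table \<Xi> m n h)) (h i) r i"
        by (cases \<Xi>) (use located_insert_Late[OF T nm x r] located_insert_Early[OF T nm x r] in metis)+
      then show ?thesis by simp
    qed
  qed simp
  then obtain r where r: "located (hash_table \<Xi> m n h) (h i) r i" ..
  with displacement_located[OF assms(1,2) r] show ?thesis by simp
qed

text \<open>On insertion the item lands behind the whole walk from its address, so the links to
  follow are as many as the occupied cells a failing search would meet, and none if the address is
  empty. The table seen by item \<open>Suc i\<close> holds \<open>i\<close> items.\<close>

lemma displacement_Late: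
  assumes "n \<le> m" "\<And>i. i \<in> {1..n} \<Longrightarrow> h i \<in> {1..m}" "i < n"
  shows "displacement Late m n h (Suc i) = unsuccessful_search Late m i h (h (Suc i))"
proof (rule displacement_located[OF assms(1,2)])
  show "located (hash_table Late m n h) (h (Suc i)) (unsuccessful_search Late m i h (h (Suc i))) (Suc i)"
    using assms
  proof (induction n)
    case (Suc n)
    have T: "valid_table m n (hash_table Late m n h)" using Suc.prems by (intro valid_hash_table) auto
    have nm: "n < m" and x: "h (Suc n) \<in> {1..m}" using Suc.prems by auto
    show ?case
    proof (cases "i = n")
      case True
      then show ?thesis using located_insert_new[OF T nm x, of Late "Suc n"]
        by (auto simp: unsuccessful_search_def Let_def search_cost_def occupied_def split: if_splits)
    next
      case False
      then have "i < n" using Suc.prems(3) by simp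
      with Suc.IH Suc.prems(1,2) have
        "located (hash_table Late m n h) (h (Suc i)) (unsuccessful_search Late m i h (h (Suc i))) (Suc i)"
        by simp
      from located_insert_Late[OF T nm x this] show ?thesis by simp
    qed
  qed simp
qed auto

text \<open>An old item is pushed back by exactly \<open>D i\<close> addresses, whence the factor
  \<open>m + k\<close>. The new item has displacement 1 at the \<open>n\<close> occupied addresses
  and 0 elsewhere, where \<open>G 0 = 0\<close> removes it.\<close>

lemma sum_displacement_Early:
  fixes G :: "nat \<Rightarrow> real"
  assumes nm: "n < m" and h: "\<And>i. i \<in> {1..n} \<Longrightarrow> h i \<in> {1..m}"
    and G: "\<And>d. real d * (G (Suc d) - G d) = k * G d" and G0: "G 0 = 0"
  shows "(\<Sum>x\<in>{1..m}. \<Sum>i\<in>{1..Suc n}. G (displacement Early m (Suc n) (h(Suc n := x)) i)) =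
    (real m + k) * (\<Sum>i\<in>{1..n}. G (displacement Early m n h i)) + real n * G 1"
proof -
  define T where "T = hash_table Early m n h"
  define D where "D i = displacement Early m n h i" for i
  have T: "valid_table m n T" unfolding T_def using nm h by (intro valid_hash_table) auto
  have ht: "hash_table Early m (Suc n) (h(Suc n := x)) = insert_item Early m (Suc n) x T" for x
    using hash_table_cong[of n "h(Suc n := x)" h] by (simp add: T_def)
  have l: "located T (h i) (D i) i" if "i \<in> {1..n}" for i
    unfolding T_def D_def using nm h that by (intro located_displacement) auto
  have D': "displacement Early m (Suc n) (h(Suc n := x)) i =
      (if i = Suc n then of_bool (x \<in> occupied T)
       else D i + of_bool (x \<in> set (take (D i) (walk_from T (h i)))))"
    if "i \<in> {1..Suc n}" "x \<in> {1..m}" for i x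
  proof (rule displacement_located)
    show "located (hash_table Early m (Suc n) (h(Suc n := x))) ((h(Suc n := x)) i)
      (if i = Suc n then of_bool (x \<in> occupied T)
       else D i + of_bool (x \<in> set (take (D i) (walk_from T (h i))))) i"
    proof (cases "i = Suc n")
      case True
      then show ?thesis
        using located_insert_new[OF T nm that(2), of Early "Suc n"] unfolding ht
        by (cases "x \<in> occupied T") simp_all
    next
      case False
      then have "i \<in> {1..n}" using that(1) by simp
      from located_insert_Early[OF T nm that(2) l[OF this], of "Suc n"] False show ?thesis
        unfolding ht by simp
    qed
    show "Suc n \<le> m" using nm by simp
    show "(h(Suc n := x)) i' \<in> {1..m}" if "i' \<in> {1..Suc n}" for i'
      using h[of i'] that \<open>x \<in> {1..m}\<close> by (cases "i' = Suc n") simp_all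
  qed
  have old: "(\<Sum>x\<in>{1..m}. G (displacement Early m (Suc n) (h(Suc n := x)) i)) = (real m + k) * G (D i)"
    if i: "i \<in> {1..n}" for i
  proof -
    let ?S = "set (take (D i) (walk_from T (h i)))"
    have a: "h i \<in> occupied T" "D i < length (walk_from T (h i))"
      using l[OF i] by (auto simp: located_def)
    note w = valid_table_walk[OF T a(1)]
    have "?S \<subseteq> {1..m}" using subset_trans[OF set_take_subset subset_trans[OF w(3) valid_tableD(1)[OF T]]] .
    then have S: "{Suc 0..m} \<inter> ?S = ?S" by auto
    have "card ?S = D i" using w(6) a(2) by (simp add: distinct_card)
    have "(\<Sum>x\<in>{1..m}. G (displacement Early m (Suc n) (h(Suc n := x)) i)) =
        (\<Sum>x\<in>{1..m}. G (D i) + of_bool (x \<in> ?S) * (G (Suc (D i)) - G (D i)))"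
      using i by (intro sum.cong) (auto simp: D')
    also have "\<dots> = m * G (D i) + D i * (G (Suc (D i)) - G (D i))"
      using \<open>card ?S = D i\<close> S by (simp add: sum.distrib flip: sum_distrib_right)
    also have "\<dots> = (m + k) * G (D i)" by (simp only: G distrib_right)
    finally show ?thesis .
  qed
  have new: "(\<Sum>x\<in>{1..m}. G (displacement Early m (Suc n) (h(Suc n := x)) (Suc n))) = n * G 1"
  proof -
    have o: "{Suc 0..m} \<inter> occupied T = occupied T" using valid_tableD(1)[OF T] by auto
    have "(\<Sum>x\<in>{1..m}. G (displacement Early m (Suc n) (h(Suc n := x)) (Suc n))) =
      (\<Sum>x\<in>{1..m}. of_bool (x \<in> occupied T) * G 1)"
      by (intro sum.cong) (auto simp: D' G0)
    also have "\<dots> = n * G 1"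
      using o valid_tableD(2)[OF T] by (simp flip: sum_distrib_right)
    finally show ?thesis .
  qed
  have "(\<Sum>x\<in>{1..m}. \<Sum>i\<in>{1..Suc n}. G (displacement Early m (Suc n) (h(Suc n := x)) i)) =
      (\<Sum>i\<in>{1..Suc n}. \<Sum>x\<in>{1..m}. G (displacement Early m (Suc n) (h(Suc n := x)) i))"
    by (rule sum.swap)
  also have "\<dots> = (\<Sum>i\<in>{1..n}. \<Sum>x\<in>{1..m}. G (displacement Early m (Suc n) (h(Suc n := x)) i)) + n * G 1"
    unfolding new[symmetric] by (rule trans[OF sum.nat_ivl_Suc' add.commute]) simp
  also have "\<dots> = (\<Sum>i\<in>{1..n}. (real m + k) * G (D i)) + n * G 1"
    by (simp only: sum.cong[OF refl old])
  finally show ?thesis unfolding D_def sum_distrib_left .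
qed

section \<open>Exact moments\<close>

lemma expectation_pair_pmf_of_set:
  fixes g :: "_ \<Rightarrow> real"
  assumes P: "finite (set_pmf P)" and B: "finite B" "B \<noteq> {}"
  shows "measure_pmf.expectation (pair_pmf P (pmf_of_set B)) g =
    measure_pmf.expectation P (\<lambda>x. (\<Sum>y\<in>B. g (x, y)) / card B)"
proof -
  have "measure_pmf.expectation (pair_pmf P (pmf_of_set B)) g =
      (\<Sum>z\<in>set_pmf P \<times> B. g z * pmf (pair_pmf P (pmf_of_set B)) z)"
    using assms by (intro integral_measure_pmf_real) auto
  also have "\<dots> = (\<Sum>x\<in>set_pmf P. \<Sum>y\<in>B. g (x, y) * (pmf P x * (1 / card B)))"
    unfolding sum.cartesian_product using B
    by (intro sum.cong) (auto simp: pmf_pair pmf_of_set[OF B(2,1)])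
  also have "\<dots> = (\<Sum>x\<in>set_pmf P. (\<Sum>y\<in>B. g (x, y)) / card B * pmf P x)"
    by (simp add: sum_distrib_left sum_distrib_right sum_divide_distrib mult_ac)
  also have "\<dots> = measure_pmf.expectation P (\<lambda>x. (\<Sum>y\<in>B. g (x, y)) / card B)"
    using P by (intro integral_measure_pmf_real[symmetric]) auto
  finally show ?thesis .
qed

lemma set_random_hashes:
  assumes "0 < m"
  shows "finite (set_pmf (random_hashes m n))"
    and "h \<in> set_pmf (random_hashes m n) \<Longrightarrow> i \<in> {1..n} \<Longrightarrow> h i \<in> {1..m}"
proof -
  have s: "set_pmf (random_hashes m n) = PiE_dflt {1..n} 0 (\<lambda>_. {1..m})"
    using assms by (simp add: random_hashes_def set_Pi_pmf o_def)
  show "finite (set_pmf (random_hashes m n))" unfolding s by (intro finite_PiE_dflt) auto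
  show "h \<in> set_pmf (random_hashes m n) \<Longrightarrow> i \<in> {1..n} \<Longrightarrow> h i \<in> {1..m}"
    unfolding s PiE_dflt_def by blast
qed

lemma random_hashes_Suc:
  "random_hashes m (Suc n) =
    map_pmf (\<lambda>(h, x). h(Suc n := x)) (pair_pmf (random_hashes m n) (pmf_of_set {1..m}))"
proof -
  have e: "{1..Suc n} = insert (Suc n) {1..n}" by auto
  have "random_hashes m (Suc n) =
      map_pmf (\<lambda>(x, h). h(Suc n := x)) (pair_pmf (pmf_of_set {1..m}) (random_hashes m n))"
    unfolding random_hashes_def e
    by (subst Pi_pmf_insert) auto
  then show ?thesis
    by (subst (asm) pair_commute_pmf) (simp add: pmf.map_comp o_def case_prod_unfold)
qed

text \<open>Conditioning on all addresses but the last. \<open>F\<close> and \<open>F'\<close>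
  differ because the averaged quantity itself depends on the number of items; the step is required
  only for addresses in range, which holds on the support.\<close>

lemma expectation_random_hashes_Suc:
  fixes F F' :: "(nat \<Rightarrow> nat) \<Rightarrow> real"
  assumes m: "0 < m"
    and step: "\<And>h. (\<And>i. i \<in> {1..n} \<Longrightarrow> h i \<in> {1..m}) \<Longrightarrow> (\<Sum>x\<in>{1..m}. F' (h(Suc n := x))) = c * F h + d"
  shows "measure_pmf.expectation (random_hashes m (Suc n)) F' =
    (c * measure_pmf.expectation (random_hashes m n) F + d) / m"
proof -
  let ?R = "random_hashes m n"
  note R = set_random_hashes[OF m, where n = n]
  have "measure_pmf.expectation (random_hashes m (Suc n)) F' =
      measure_pmf.expectation ?R (\<lambda>h. (\<Sum>x\<in>{1..m}. F' (h(Suc n := x))) / m)"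
    unfolding random_hashes_Suc using m R by (simp add: expectation_pair_pmf_of_set)
  also have "\<dots> = measure_pmf.expectation ?R (\<lambda>h. (c * F h + d) / m)"
    using R step by (intro integral_cong_AE) (simp_all add: AE_measure_pmf_iff)
  also have "\<dots> = (c * measure_pmf.expectation ?R F + d) / m"
    using R by (simp add: integrable_measure_pmf_finite)
  finally show ?thesis .
qed

lemma expectation_random_hashes_0: "measure_pmf.expectation (random_hashes m 0) F = (F (\<lambda>_. 0) :: real)"
  by (simp add: random_hashes_def)

section \<open>Recurrences and closed forms for the moments\<close>

lemma finite_d_unsuccessful: "0 < m \<Longrightarrow> finite (set_pmf (d_unsuccessful \<Xi> m n))"
  using set_random_hashes(1)[of m n] by (auto simp: d_unsuccessful_def)

lemma finite_d_successful: "0 < m \<Longrightarrow> 0 < n \<Longrightarrow> finite (set_pmf (d_successful \<Xi> m n))"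
  using set_random_hashes(1)[of m n] by (auto simp: d_successful_def)

lemma expectation_d_unsuccessful:
  assumes "0 < m"
  shows "measure_pmf.expectation (d_unsuccessful \<Xi> m n) (G :: nat \<Rightarrow> real) =
    measure_pmf.expectation (random_hashes m n) (\<lambda>h. \<Sum>j\<in>{1..m}. G (unsuccessful_search \<Xi> m n h j)) / m"
  unfolding d_unsuccessful_def using assms set_random_hashes(1)[of m n]
  by (simp add: expectation_pair_pmf_of_set)

lemma expectation_d_successful:
  assumes "0 < m" "0 < n"
  shows "measure_pmf.expectation (d_successful \<Xi> m n) (G :: nat \<Rightarrow> real) =
    measure_pmf.expectation (random_hashes m n) (\<lambda>h. \<Sum>i\<in>{1..n}. G (displacement \<Xi> m n h i)) / n"
  unfolding d_successful_def using assms set_random_hashes(1)[of m n]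
  by (simp add: expectation_pair_pmf_of_set)

lemma unsuccessful_search_eq: "unsuccessful_search \<Xi> m n h = search_cost (hash_table \<Xi> m n h)"
  by (simp add: unsuccessful_search_def search_cost_def Let_def fun_eq_iff)

lemma search_cost_unoccupied: "c \<notin> occupied T \<Longrightarrow> search_cost T c = 0"
  by (simp add: search_cost_def occupied_def)

lemma sum_search_cost_occupied:
  fixes G :: "nat \<Rightarrow> real"
  assumes "valid_table m n T" "G 0 = 0"
  shows "(\<Sum>j\<in>{1..m}. G (search_cost T j)) = (\<Sum>j\<in>occupied T. G (search_cost T j))"
  using assms valid_tableD(1)[OF assms(1)]
  by (intro sum.mono_neutral_right) (auto simp: search_cost_unoccupied)

lemma expectation_d_unsuccessful_Suc:
  fixes G :: "nat \<Rightarrow> real"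
  assumes nm: "n < m" and G: "\<And>d. real d * (G (Suc d) - G d) = k * G d" "G 0 = 0"
  shows "measure_pmf.expectation (d_unsuccessful \<Xi> m (Suc n)) G =
    (1 + (k + 1) / m) * measure_pmf.expectation (d_unsuccessful \<Xi> m n) G + (1 - n / m) * G 1 / m"
proof -
  let ?F = "\<lambda>n h. \<Sum>j\<in>{1..m}. G (unsuccessful_search \<Xi> m n h j)"
  have m: "0 < m" using nm by simp
  have "measure_pmf.expectation (random_hashes m (Suc n)) (?F (Suc n)) =
      ((real m + 1 + k) * measure_pmf.expectation (random_hashes m n) (?F n) + (real m - real n) * G 1) / m"
  proof (rule expectation_random_hashes_Suc[OF m])
    fix h :: "nat \<Rightarrow> nat" assume h: "\<And>i. i \<in> {1..n} \<Longrightarrow> h i \<in> {1..m}"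
    define T where "T = hash_table \<Xi> m n h"
    have T: "valid_table m n T" unfolding T_def using nm h by (intro valid_hash_table) auto
    have ht: "hash_table \<Xi> m (Suc n) (h(Suc n := x)) = insert_item \<Xi> m (Suc n) x T" for x
      using hash_table_cong[of n "h(Suc n := x)" h] by (simp add: T_def)
    have "(\<Sum>x\<in>{1..m}. ?F (Suc n) (h(Suc n := x))) =
      (\<Sum>x\<in>{1..m}. \<Sum>c\<in>occupied (insert_item \<Xi> m (Suc n) x T). G (search_cost (insert_item \<Xi> m (Suc n) x T) c))"
      unfolding unsuccessful_search_eq ht
      by (intro sum.cong refl sum_search_cost_occupied[where G = G, OF valid_table_insert[OF T nm] G(2)])
    also have "\<dots> = (real m + 1 + k) * (\<Sum>c\<in>occupied T. G (search_cost T c)) + (real m - real n) * G 1"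
      by (rule sum_search_cost_insert[OF T nm G(1)])
    also have "(\<Sum>c\<in>occupied T. G (search_cost T c)) = ?F n h"
      unfolding unsuccessful_search_eq T_def[symmetric]
      by (rule sum_search_cost_occupied[where G = G, OF T G(2), symmetric])
    finally show "(\<Sum>x\<in>{1..m}. ?F (Suc n) (h(Suc n := x))) =
      (real m + 1 + k) * ?F n h + (real m - real n) * G 1" .
  qed
  then show ?thesis
    unfolding expectation_d_unsuccessful[OF m] using m by (simp only:) (simp add: field_simps)
qed

lemma expectation_d_unsuccessful_0:
  "0 < m \<Longrightarrow> G 0 = 0 \<Longrightarrow> measure_pmf.expectation (d_unsuccessful \<Xi> m 0) (G :: nat \<Rightarrow> real) = 0"
  by (simp add: expectation_d_unsuccessful expectation_random_hashes_0 unsuccessful_search_def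
      empty_table_def)

text \<open>
  The particular solution of the recurrence is affine in \<open>n / m\<close>, with coefficients independent
  of \<open>m\<close>.
\<close>

lemma expectation_d_unsuccessful_closed:
  fixes G :: "nat \<Rightarrow> real"
  assumes G: "\<And>d. real d * (G (Suc d) - G d) = k * G d" "G 0 = 0" and k: "k + 1 = K" "0 < K"
    and b: "b = G 1 / K" and a: "a = (b - G 1) / K"
  shows "0 < m \<Longrightarrow> n \<le> m \<Longrightarrow> measure_pmf.expectation (d_unsuccessful \<Xi> m n) G =
    a + b * (n / m) - a * (1 + K / m) ^ n"
proof (induction n)
  case 0
  then show ?case using G by (simp add: expectation_d_unsuccessful_0)
next
  case (Suc n)
  let ?q = "1 + K / m"
  \<comment> \<open>With these values the numerator over \<open>m\<close> below collapses to
    \<open>b\<close>, and \<open>b / m\<close> moves \<open>n / m\<close> on to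
    \<open>Suc n / m\<close>. The geometric part has coefficient \<open>- a\<close> because the
    moment is 0 for the empty table.\<close>
  have ab: "K * a = b - G 1" "K * b = G 1" using k a b by auto
  have "measure_pmf.expectation (d_unsuccessful \<Xi> m (Suc n)) G =
      ?q * (a + b * (n / m) - a * ?q ^ n) + (1 - n / m) * G 1 / m"
    using Suc by (subst expectation_d_unsuccessful_Suc[OF _ G]) (simp_all add: k)
  also have "\<dots> = a + b * (n / m) + (K * a + K * b * (n / m) + (1 - n / m) * G 1) / m - a * ?q ^ Suc n"
    by (simp add: algebra_simps add_divide_distrib diff_divide_distrib)
  also have "\<dots> = a + b * (Suc n / m) - a * ?q ^ Suc n"
    unfolding ab by (simp add: algebra_simps add_divide_distrib diff_divide_distrib)
  finally show ?case .
qed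

text \<open>The address of item \<open>Suc i\<close> is uniform and independent of the first
  \<open>i\<close>, so its expected displacement is a moment of \<open>d_unsuccessful\<close> with
  \<open>i\<close> items.\<close>

lemma expectation_displacement_Late:
  fixes G :: "nat \<Rightarrow> real"
  assumes m: "0 < m" and "n \<le> m"
  shows "measure_pmf.expectation (random_hashes m n) (\<lambda>h. \<Sum>i\<in>{1..n}. G (displacement Late m n h i)) =
    (\<Sum>i<n. measure_pmf.expectation (d_unsuccessful Late m i) G)"
  using \<open>n \<le> m\<close>
proof (induction n)
  case 0
  then show ?case by simp
next
  case (Suc n)
  let ?U = "\<lambda>h. \<Sum>x\<in>{1..m}. G (unsuccessful_search Late m n h x)"
  let ?F = "\<lambda>n h. \<Sum>i\<in>{1..n}. G (displacement Late m n h i)"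
  have s: "(\<Sum>i\<in>{1..n}. F i) = (\<Sum>i<n. F (Suc i))" for n and F :: "nat \<Rightarrow> real"
    using sum.atLeast1_atMost_eq by simp
  \<comment> \<open>The functional at stage \<open>n\<close> already contains the search costs over
    all next addresses; the factor 1 and the constant 0 fit it to the one-step lemma.\<close>
  have "measure_pmf.expectation (random_hashes m (Suc n)) (?F (Suc n)) =
      (1 * measure_pmf.expectation (random_hashes m n) (\<lambda>h. m * ?F n h + ?U h) + 0) / m"
  proof (rule expectation_random_hashes_Suc[OF m])
    fix h :: "nat \<Rightarrow> nat" assume h: "\<And>i. i \<in> {1..n} \<Longrightarrow> h i \<in> {1..m}"
    have "?F (Suc n) (h(Suc n := x)) = ?F n h + G (unsuccessful_search Late m n h x)"
      if x: "x \<in> {1..m}" for x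
    proof -
      have hx: "(h(Suc n := x)) i \<in> {1..m}" if "i \<in> {1..Suc n}" for i
        using h[of i] that x by (cases "i = Suc n") simp_all
      have us: "unsuccessful_search Late m i (h(Suc n := x)) = unsuccessful_search Late m i h"
        if "i \<le> n" for i
        unfolding unsuccessful_search_eq using that hash_table_cong[of i "h(Suc n := x)" h] by simp
      have d: "displacement Late m (Suc n) (h(Suc n := x)) (Suc i) =
          unsuccessful_search Late m i h ((h(Suc n := x)) (Suc i))" if "i \<le> n" for i
        unfolding us[OF that, symmetric]
        using Suc.prems that hx by (intro displacement_Late) (simp_all only: less_Suc_eq_le)
      have d': "displacement Late m n h (Suc i) = unsuccessful_search Late m i h (h (Suc i))" if "i < n" for i
        using Suc.prems that h by (intro displacement_Late) simp_all
      show ?thesis unfolding s by (simp add: d d')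
    qed
    then have "(\<Sum>x\<in>{1..m}. ?F (Suc n) (h(Suc n := x))) =
        (\<Sum>x\<in>{1..m}. ?F n h + G (unsuccessful_search Late m n h x))"
      by (intro sum.cong refl)
    then show "(\<Sum>x\<in>{1..m}. ?F (Suc n) (h(Suc n := x))) = 1 * (m * ?F n h + ?U h) + 0"
      by (simp add: sum.distrib)
  qed
  also have "\<dots> = measure_pmf.expectation (random_hashes m n) (?F n) +
      measure_pmf.expectation (d_unsuccessful Late m n) G"
    unfolding expectation_d_unsuccessful[OF m] using m set_random_hashes(1)[OF m, of n]
    by (simp add: integrable_measure_pmf_finite add_divide_distrib)
  finally show ?case using Suc by simp
qed

lemma sum_affine_geometric:
  fixes K a b :: real
  assumes "0 < K" "0 < m"
  shows "(\<Sum>i<n. a + b * (i / m) - a * (1 + K / m) ^ i) =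
    a * n + b * (real n * (real n - 1) / (2 * m)) - a * m * ((1 + K / m) ^ n - 1) / K"
proof (induction n)
  case (Suc n)
  define Q where "Q = (1 + K / m) ^ n"
  show ?case
    unfolding sum.lessThan_Suc Suc power_Suc Q_def[symmetric] using assms by (simp add: field_simps)
qed simp

text \<open>Each step multiplies by \<open>1 + k / m\<close> and adds \<open>n * G 1 / m\<close>.
  The solution affine in \<open>n\<close> has slope \<open>- G 1 / k\<close> and constant
  \<open>- m * G 1 / k^2\<close>; the geometric part cancels that constant at
  \<open>n = 0\<close>.\<close>

lemma expectation_displacement_Early:
  fixes G :: "nat \<Rightarrow> real"
  assumes m: "0 < m"
    and G: "\<And>d. real d * (G (Suc d) - G d) = k * G d" "G 0 = 0" and k: "0 < k"
  shows "n \<le> m \<Longrightarrow>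
    measure_pmf.expectation (random_hashes m n) (\<lambda>h. \<Sum>i\<in>{1..n}. G (displacement Early m n h i)) =
    G 1 / k\<^sup>2 * m * ((1 + k / m) ^ n - 1) - G 1 / k * n"
proof (induction n)
  case 0
  then show ?case by simp
next
  case (Suc n)
  let ?F = "\<lambda>n h. \<Sum>i\<in>{1..n}. G (displacement Early m n h i)"
  have "measure_pmf.expectation (random_hashes m (Suc n)) (?F (Suc n)) =
      ((real m + k) * measure_pmf.expectation (random_hashes m n) (?F n) + real n * G 1) / m"
    using Suc.prems by (intro expectation_random_hashes_Suc[OF m] sum_displacement_Early G) simp_all
  moreover define P where "P = (1 + k / m) ^ n"
  ultimately show ?case
    unfolding power_Suc P_def[symmetric] using Suc m k
    by (simp only: P_def[symmetric]) (simp add: field_simps power2_eq_square)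
qed

section \<open>Variances from rising factorial moments\<close>

lemma Var_eq:
  assumes "integrable (measure_pmf P) real" "integrable (measure_pmf P) (\<lambda>d. real d * (real d + 1))"
  shows "Var P = measure_pmf.expectation P (\<lambda>d. real d * (real d + 1)) - measure_pmf.expectation P real
    - (measure_pmf.expectation P real)\<^sup>2"
proof -
  have sq: "(\<lambda>d. (real d)\<^sup>2) = (\<lambda>d. real d * (real d + 1) - real d)"
    by (simp add: fun_eq_iff power2_eq_square algebra_simps)
  have "integrable (measure_pmf P) (\<lambda>d. (real d)\<^sup>2)" unfolding sq using assms by simp
  then have "Var P = measure_pmf.expectation P (\<lambda>d. (real d)\<^sup>2) - (measure_pmf.expectation P real)\<^sup>2"
    unfolding Var_def by (intro measure_pmf.variance_eq assms)
  then show ?thesis unfolding sq using assms by simp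
qed

text \<open>Replacing \<open>d\<close> by \<open>max d 1\<close> changes \<open>d\<close> and
  \<open>d (d + 1)\<close> only at 0, by 1 and by 2, so the mass at 0 is the one additional quantity
  to control.\<close>

lemma Var_probes_eq:
  assumes "integrable (measure_pmf P) real" "integrable (measure_pmf P) (\<lambda>d. real d * (real d + 1))"
  shows "Var (probes P) = measure_pmf.expectation P (\<lambda>d. real d * (real d + 1)) + pmf P 0
    - measure_pmf.expectation P real - (measure_pmf.expectation P real + pmf P 0)\<^sup>2"
proof -
  have i: "integrable (measure_pmf P) (indicator {0} :: nat \<Rightarrow> real)"
    "measure_pmf.expectation P (indicator {0}) = pmf P 0"
    by (auto simp: measure_pmf_single less_top[symmetric])
  have 1: "(\<lambda>d. real (max d 1)) = (\<lambda>d. real d + indicator {0} d)"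
    by (auto simp: fun_eq_iff indicator_def)
  have 2: "(\<lambda>d. real (max d 1) * (real (max d 1) + 1)) = (\<lambda>d. real d * (real d + 1) + 2 * indicator {0} d)"
    by (auto simp: fun_eq_iff indicator_def)
  have "Var (probes P) = measure_pmf.expectation P (\<lambda>d. real (max d 1) * (real (max d 1) + 1))
    - measure_pmf.expectation P (\<lambda>d. real (max d 1)) - (measure_pmf.expectation P (\<lambda>d. real (max d 1)))\<^sup>2"
    unfolding probes_def
  proof (subst Var_eq)
    show "integrable (map_pmf (\<lambda>k. max k 1) P) real"
      "integrable (map_pmf (\<lambda>k. max k 1) P) (\<lambda>d. real d * (real d + 1))"
      unfolding integrable_map_pmf_eq 1 2 using assms i by simp_all
  qed simp
  then show ?thesis unfolding 1 2 using assms i by simp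
qed

text \<open>The number of empty cells is not random: every outcome leaves exactly
  \<open>m - n\<close> of them.\<close>

lemma pmf_d_unsuccessful_0:
  assumes m: "0 < m" and "n \<le> m"
  shows "pmf (d_unsuccessful \<Xi> m n) 0 = 1 - n / m"
proof -
  have "pmf (d_unsuccessful \<Xi> m n) 0 = measure_pmf.expectation (d_unsuccessful \<Xi> m n) (indicator {0})"
    by (simp add: measure_pmf_single)
  also have "\<dots> = measure_pmf.expectation (random_hashes m n)
      (\<lambda>h. \<Sum>j\<in>{1..m}. indicator {0} (unsuccessful_search \<Xi> m n h j)) / m"
    by (rule expectation_d_unsuccessful[OF m])
  also have "measure_pmf.expectation (random_hashes m n)
      (\<lambda>h. \<Sum>j\<in>{1..m}. indicator {0} (unsuccessful_search \<Xi> m n h j)) =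
    measure_pmf.expectation (random_hashes m n) (\<lambda>h. real m - real n)"
  proof (intro integral_cong_AE)
    have "(\<Sum>j\<in>{1..m}. indicator {0} (unsuccessful_search \<Xi> m n h j)) = real m - real n"
      if h: "h \<in> set_pmf (random_hashes m n)" for h
    proof -
      define T where "T = hash_table \<Xi> m n h"
      have T: "valid_table m n T" unfolding T_def
        using set_random_hashes(2)[OF m h] \<open>n \<le> m\<close> by (intro valid_hash_table)
      note O = valid_tableD(1-3)[OF T]
      have "(\<Sum>j\<in>{1..m}. indicator {0} (unsuccessful_search \<Xi> m n h j)) =
          (\<Sum>j\<in>{1..m}. (of_bool (j \<notin> occupied T) :: real))"
        unfolding unsuccessful_search_eq T_def[symmetric]
        by (intro sum.cong) (auto simp: search_cost_def occupied_def)
      also have "\<dots> = (\<Sum>j\<in>{1..m}. 1 - of_bool (j \<in> occupied T))"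
        by (intro sum.cong) auto
      also have "\<dots> = real m - real n"
        using O by (simp add: sum_subtractf Int_absorb1)
      finally show ?thesis .
    qed
    then show "AE h in random_hashes m n.
      (\<Sum>j\<in>{1..m}. indicator {0} (unsuccessful_search \<Xi> m n h j)) = real m - real n"
      by (simp add: AE_measure_pmf_iff)
  qed simp_all
  finally show ?thesis using m by (simp add: diff_divide_distrib)
qed

section \<open>Limits\<close>

text \<open>The continuous extension of \<open>(exp x - 1) / x\<close>. Stating limits with it makes
  a separate treatment of \<alpha> = 0 unnecessary.\<close>

definition exprel :: "real \<Rightarrow> real" where
  "exprel x = (if x = 0 then 1 else (exp x - 1) / x)"

lemma isCont_exprel: "isCont exprel x"
proof (cases "x = 0")
  case True
  have "((\<lambda>x :: real. (exp x - 1) / x) \<longlongrightarrow> 1) (at 0)" by real_asymp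
  then have "(exprel \<longlongrightarrow> 1) (at 0)"
    by (rule Lim_transform_eventually) (auto simp: exprel_def eventually_at_filter)
  then show ?thesis using True by (simp add: isCont_def exprel_def)
next
  case False
  have "isCont (\<lambda>x. (exp x - 1) / x) x" using False by (intro continuous_intros) auto
  moreover have "\<forall>\<^sub>F y in nhds x. exprel y = (exp y - 1) / y"
    using t1_space_nhds[OF False] by eventually_elim (simp add: exprel_def)
  ultimately show ?thesis by (simp add: isCont_cong)
qed

lemma exprel_mult: "exprel x * x = exp x - 1"
  by (simp add: exprel_def)

context
  fixes m n :: "nat \<Rightarrow> nat" and \<alpha> K :: real
  assumes m: "filterlim m at_top sequentially"
    and nm: "\<And>i. 0 < n i \<and> n i \<le> m i"
    and \<alpha>: "(\<lambda>i. real (n i) / real (m i)) \<longlonglongrightarrow> \<alpha>"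
    and K: "0 < K"
begin

private lemma scaled_ln: "(\<lambda>i. m i * ln (1 + K / m i)) \<longlonglongrightarrow> K"
proof -
  have "((\<lambda>x. x * ln (1 + K / x)) \<longlongrightarrow> K) at_top" using K by real_asymp
  from filterlim_compose[OF this filterlim_compose[OF filterlim_real_sequentially m]]
  show ?thesis .
qed

private lemma exponent: "(\<lambda>i. n i * ln (1 + K / m i)) \<longlonglongrightarrow> K * \<alpha>"
proof -
  have "(\<lambda>i. n i / m i * (m i * ln (1 + K / m i))) \<longlonglongrightarrow> \<alpha> * K"
    by (intro tendsto_mult \<alpha> scaled_ln)
  moreover have "n i / m i * (m i * ln (1 + K / m i)) = n i * ln (1 + K / m i)" for i
    using nm[of i] by simp
  ultimately show ?thesis by (simp only: mult.commute)
qed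

private lemma power_eq: "(1 + K / m i) ^ n i = exp (n i * ln (1 + K / m i))"
  using K by (simp add: exp_of_nat_mult add_pos_nonneg)

lemma tendsto_growth: "(\<lambda>i. (1 + K / m i) ^ n i) \<longlonglongrightarrow> exp (K * \<alpha>)"
  unfolding power_eq by (intro tendsto_intros exponent)

text \<open>Put y = n ln (1 + K / m). The power minus 1 is \<open>exprel y * y\<close>, and the
  \<open>n\<close> in y cancels the denominator, so the limit exists even if \<open>m / n\<close> is
  unbounded.\<close>

lemma tendsto_growth_quotient:
  "(\<lambda>i. m i / n i * ((1 + K / m i) ^ n i - 1)) \<longlonglongrightarrow> K * exprel (K * \<alpha>)"
proof -
  have "(\<lambda>i. m i * ln (1 + K / m i) * exprel (n i * ln (1 + K / m i))) \<longlonglongrightarrow> K * exprel (K * \<alpha>)"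
    by (intro tendsto_mult scaled_ln isCont_tendsto_compose[OF isCont_exprel] exponent)
  moreover have "m i * ln (1 + K / m i) * exprel (n i * ln (1 + K / m i)) =
      m i / n i * ((1 + K / m i) ^ n i - 1)" for i
  proof -
    have "m i / n i * ((1 + K / m i) ^ n i - 1) =
        m i / n i * (exprel (n i * ln (1 + K / m i)) * (n i * ln (1 + K / m i)))"
      unfolding power_eq exprel_mult ..
    then show ?thesis using nm[of i] by simp
  qed
  ultimately show ?thesis by (simp only:)
qed

end

section \<open>Moments of mixtures of geometric laws\<close>

lemma expectation_nat_sums:
  fixes g :: "nat \<Rightarrow> real"
  assumes "\<And>k. 0 \<le> g k" "(\<lambda>k. pmf P k * g k) sums s"
  shows "integrable (measure_pmf P) g" "measure_pmf.expectation P g = s"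
proof -
  have "integrable (count_space UNIV) (\<lambda>k. pmf P k * g k)"
    unfolding integrable_count_space_nat_iff using assms by (auto simp: sums_iff)
  then have i: "integrable (count_space UNIV) (\<lambda>k. pmf P k *\<^sub>R g k)" by simp
  show "integrable (measure_pmf P) g"
    unfolding measure_pmf_eq_density using i by (subst integrable_density) auto
  have "measure_pmf.expectation P g = integral\<^sup>L (count_space UNIV) (\<lambda>k. pmf P k *\<^sub>R g k)"
    unfolding measure_pmf_eq_density by (subst integral_density) auto
  also have "\<dots> = s"
    using sums_unique2[OF sums_integral_count_space_nat[OF i]] assms(2) by simp
  finally show "measure_pmf.expectation P g = s" .
qed

text \<open>Sum and integral are exchanged by dominated convergence: all terms are nonnegative, so
  the full sum \<open>f t * s t\<close>, integrable by assumption, bounds every partial sum.\<close>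

lemma geometric_mixture_weighted_sums:
  fixes f s :: "real \<Rightarrow> real" and c :: "nat \<Rightarrow> real"
  assumes f: "continuous_on {0..a} f" "\<And>t. t \<in> {0..a} \<Longrightarrow> 0 \<le> f t"
    and c: "\<And>k. 0 \<le> c k"
    and s: "\<And>t. t \<in> {0..a} \<Longrightarrow> (\<lambda>k. c k * (1 - exp (- t)) ^ k) sums s t"
    and I: "((\<lambda>t. f t * s t) has_integral I) {0..a}"
  shows "(\<lambda>k. c k * integral {0..a} (\<lambda>t. f t * (1 - exp (- t)) ^ k)) sums I"
proof -
  let ?S = "\<lambda>N t. \<Sum>k<N. c k * (f t * (1 - exp (- t)) ^ k)"
  have int: "(\<lambda>t. f t * (1 - exp (- t)) ^ k) integrable_on {0..a}" for k :: nat
    by (intro integrable_continuous_real continuous_intros f)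
  have S: "?S N t = f t * (\<Sum>k<N. c k * (1 - exp (- t)) ^ k)" for N t
    by (simp add: sum_distrib_left mult_ac)
  have pos: "0 \<le> c k * (1 - exp (- t)) ^ k" if "t \<in> {0..a}" for k t
    using c that by simp
  have le: "(\<Sum>k<N. c k * (1 - exp (- t)) ^ k) \<le> s t" if "t \<in> {0..a}" for t N
    using sum_le_suminf[of "\<lambda>k. c k * (1 - exp (- t)) ^ k" "{..<N}"] s[OF that] pos[OF that]
    by (auto simp: sums_iff)
  have "(\<lambda>N. integral {0..a} (?S N)) \<longlonglongrightarrow> integral {0..a} (\<lambda>t. f t * s t)"
  proof (rule dominated_convergence(2))
    show "?S N integrable_on {0..a}" for N
      by (intro integrable_sum integrable_on_mult_right int) auto
    show "(\<lambda>t. f t * s t) integrable_on {0..a}" using I by auto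
    show "norm (?S N t) \<le> f t * s t" if "t \<in> {0..a}" for N t
    proof -
      have "0 \<le> (\<Sum>k<N. c k * (1 - exp (- t)) ^ k)" by (intro sum_nonneg pos that)
      then show ?thesis
        unfolding S using f(2)[OF that] le[OF that, of N] by (simp add: abs_mult mult_left_mono)
    qed
    show "(\<lambda>N. ?S N t) \<longlonglongrightarrow> f t * s t" if "t \<in> {0..a}" for t
      unfolding S using s[OF that] by (intro tendsto_mult tendsto_const) (simp add: sums_def)
  qed
  moreover have "integral {0..a} (?S N) = (\<Sum>k<N. c k * integral {0..a} (\<lambda>t. f t * (1 - exp (- t)) ^ k))" for N
    by (subst integral_sum) (auto intro!: integrable_on_mult_right int)
  ultimately show ?thesis using I by (simp add: sums_def integral_unique)
qed

text \<open>These are the weights d (d + 1) at d = k + 1: the mass at \<open>Suc k\<close> carries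
  the power \<open>k\<close>.\<close>

lemma sums_geometric_second_deriv:
  fixes q :: real
  assumes q: "norm q < 1"
  shows "(\<lambda>k. real (Suc k) * real (Suc (Suc k)) * q ^ k) sums (2 / (1 - q) ^ 3)"
proof -
  have "(\<lambda>k. diffs (\<lambda>n. real (Suc n)) k * q ^ k) sums (2 / (1 - q) ^ 3)"
  proof (rule termdiffs_sums_strong[where f = "\<lambda>z. 1 / (1 - z)\<^sup>2" and K = 1])
    show "(\<lambda>n. real (Suc n) * z ^ n) sums (1 / (1 - z)\<^sup>2)" if "norm z < 1" for z :: real
      using geometric_deriv_sums[of z] that by simp
    show "((\<lambda>z. 1 / (1 - z)\<^sup>2) has_field_derivative 2 / (1 - q) ^ 3) (at q)"
      using q by (auto intro!: derivative_eq_intros simp: divide_simps power2_eq_square power3_eq_cube)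
  qed (use q in auto)
  then show ?thesis by (simp add: diffs_def mult_ac)
qed

text \<open>For fixed \<open>t\<close> the ratio is \<open>1 - exp (- t)\<close>, so the two
  weighted series are \<open>exp (2 * t)\<close> and \<open>2 * exp (3 * t)\<close>. The constant
  \<open>C\<close> is 1 for \<open>D_U\<close> and \<open>1 / \<alpha>\<close> for the other two
  laws.\<close>

lemma geometric_mixture_moments:
  fixes f :: "real \<Rightarrow> real" and P :: "nat pmf"
  assumes f: "continuous_on {0..a} f" "\<And>t. t \<in> {0..a} \<Longrightarrow> 0 \<le> f t"
    and P: "\<And>k. pmf P (Suc k) = C * integral {0..a} (\<lambda>t. f t * (1 - exp (- t)) ^ k)"
    and I: "((\<lambda>t. f t * exp (2 * t)) has_integral I) {0..a}"
    and J: "((\<lambda>t. f t * exp (3 * t)) has_integral J) {0..a}"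
  shows "integrable (measure_pmf P) real" "measure_pmf.expectation P real = C * I"
    "integrable (measure_pmf P) (\<lambda>d. real d * (real d + 1))"
    "measure_pmf.expectation P (\<lambda>d. real d * (real d + 1)) = 2 * C * J"
proof -
  have n: "norm (1 - exp (- t)) < 1" if "t \<in> {0..a}" for t
    using that by auto
  have e: "1 / exp (- t) ^ k = exp (real k * t)" for t k
    by (simp add: exp_of_nat_mult exp_minus power_inverse divide_inverse)
  have 1: "(\<lambda>k. real (Suc k) * integral {0..a} (\<lambda>t. f t * (1 - exp (- t)) ^ k)) sums I"
  proof (rule geometric_mixture_weighted_sums[OF f])
    show "(\<lambda>k. real (Suc k) * (1 - exp (- t)) ^ k) sums exp (2 * t)" if "t \<in> {0..a}" for t
      using geometric_deriv_sums[OF n[OF that]] e[of t 2] by simp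
  qed (use I in auto)
  have 2: "(\<lambda>k. real (Suc k) * real (Suc (Suc k)) * integral {0..a} (\<lambda>t. f t * (1 - exp (- t)) ^ k)) sums (2 * J)"
  proof (rule geometric_mixture_weighted_sums[OF f])
    show "(\<lambda>k. real (Suc k) * real (Suc (Suc k)) * (1 - exp (- t)) ^ k) sums (2 * exp (3 * t))"
      if "t \<in> {0..a}" for t
    proof -
      have "2 / exp (- t) ^ 3 = 2 * exp (3 * t)" using e[of t 3] by simp
      with sums_geometric_second_deriv[OF n[OF that]] show ?thesis by simp
    qed
    show "((\<lambda>t. f t * (2 * exp (3 * t))) has_integral 2 * J) {0..a}"
      using has_integral_mult_right[OF J, of 2] by (simp add: mult_ac)
  qed auto
  have "(\<lambda>k. pmf P (Suc k) * real (Suc k)) sums (C * I)"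
    using sums_mult[OF 1, of C] by (simp add: P mult_ac)
  \<comment> \<open>The term at index 0 vanishes, so the shift costs nothing.\<close>
  then have "(\<lambda>k. pmf P k * real k) sums (C * I)" by (subst (asm) sums_Suc_iff) simp
  from expectation_nat_sums[OF _ this]
  show "integrable (measure_pmf P) real" "measure_pmf.expectation P real = C * I" by simp_all
  have "(\<lambda>k. pmf P (Suc k) * (real (Suc k) * (real (Suc k) + 1))) sums (2 * C * J)"
    using sums_mult[OF 2, of C] by (simp add: P mult_ac add_ac)
  then have "(\<lambda>k. pmf P k * (real k * (real k + 1))) sums (2 * C * J)"
    by (subst (asm) sums_Suc_iff) simp
  from expectation_nat_sums[OF _ this]
  show "integrable (measure_pmf P) (\<lambda>d. real d * (real d + 1))"
    "measure_pmf.expectation P (\<lambda>d. real d * (real d + 1)) = 2 * C * J" by simp_all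
qed

text \<open>\<open>V\<close> extends \<open>F\<close> continuously to 0; the value that division by
  zero assigns to \<open>F\<close> at 0 never enters.\<close>

lemma has_value_atI:
  assumes "v = V \<alpha>" "isCont V 0" "\<And>x. x \<noteq> 0 \<Longrightarrow> F x = V x"
  shows "has_value_at F \<alpha> v"
proof (cases "\<alpha> = 0")
  case True
  have "(V \<longlongrightarrow> V 0) (at_right 0)"
    using assms(2) by (simp add: isCont_def filterlim_at_split)
  then have "(F \<longlongrightarrow> V 0) (at_right 0)"
    by (rule Lim_transform_eventually) (auto simp: assms(3) eventually_at_filter)
  then show ?thesis using True by (simp add: has_value_at_def assms(1))
qed (simp add: has_value_at_def assms)

lemma D_U_moments:
  assumes "0 \<le> \<alpha>" "\<alpha> \<le> 1"
  shows "integrable (measure_pmf (D_U \<alpha>)) real"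
    "measure_pmf.expectation (D_U \<alpha>) real = - 1 / 4 + \<alpha> / 2 + exp (2 * \<alpha>) / 4"
    "integrable (measure_pmf (D_U \<alpha>)) (\<lambda>d. real d * (real d + 1))"
    "measure_pmf.expectation (D_U \<alpha>) (\<lambda>d. real d * (real d + 1)) =
      - 4 / 9 + 2 / 3 * \<alpha> + 4 / 9 * exp (3 * \<alpha>)"
proof -
  have ftc: "((\<lambda>t. (1 - \<alpha> + t) * exp (K * t)) has_integral
      ((1 - \<alpha> + \<alpha>) / K - 1 / K\<^sup>2) * exp (K * \<alpha>) - ((1 - \<alpha> + 0) / K - 1 / K\<^sup>2) * exp (K * 0)) {0..\<alpha>}"
    if "K \<noteq> 0" for K :: real
    using assms that
    by (intro fundamental_theorem_of_calculus[where f = "\<lambda>t. ((1 - \<alpha> + t) / K - 1 / K\<^sup>2) * exp (K * t)"])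
      (auto intro!: derivative_eq_intros simp: field_simps power2_eq_square
        simp flip: has_real_derivative_iff_has_vector_derivative)
  have P: "pmf (D_U \<alpha>) (Suc k) = 1 * integral {0..\<alpha>} (\<lambda>t. (1 - \<alpha> + t) * (1 - exp (- t)) ^ k)" for k
    using assms by (simp add: pmf_D_U p_U_def)
  have c: "continuous_on {0..\<alpha>} (\<lambda>t. 1 - \<alpha> + t)" by (intro continuous_intros)
  have nn: "0 \<le> 1 - \<alpha> + t" if "t \<in> {0..\<alpha>}" for t using assms that by simp
  note M = geometric_mixture_moments[OF c nn P ftc[of 2] ftc[of 3], simplified]
  show "integrable (measure_pmf (D_U \<alpha>)) real"
    "measure_pmf.expectation (D_U \<alpha>) real = - 1 / 4 + \<alpha> / 2 + exp (2 * \<alpha>) / 4"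
    "integrable (measure_pmf (D_U \<alpha>)) (\<lambda>d. real d * (real d + 1))"
    "measure_pmf.expectation (D_U \<alpha>) (\<lambda>d. real d * (real d + 1)) =
      - 4 / 9 + 2 / 3 * \<alpha> + 4 / 9 * exp (3 * \<alpha>)"
    using M by (simp_all add: field_simps)
qed

lemma D_L_moments:
  assumes "0 \<le> \<alpha>" "\<alpha> \<le> 1"
  shows "integrable (measure_pmf (D_L \<alpha>)) real"
    "measure_pmf.expectation (D_L \<alpha>) real = - 1 / 4 + \<alpha> / 4 + exprel (2 * \<alpha>) / 4"
    "integrable (measure_pmf (D_L \<alpha>)) (\<lambda>d. real d * (real d + 1))"
    "measure_pmf.expectation (D_L \<alpha>) (\<lambda>d. real d * (real d + 1)) =
      - 4 / 9 + \<alpha> / 3 + 4 / 9 * exprel (3 * \<alpha>)"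
proof -
  \<comment> \<open>Repeated integration by parts: p / K - p' / K^2 + p'' / K^3 for the quadratic
    weight p, with p'' = -1.\<close>
  let ?F = "\<lambda>K t. ((\<alpha> - t - (\<alpha> - t)\<^sup>2 / 2) / K + (1 - (\<alpha> - t)) / K\<^sup>2 - 1 / K ^ 3) * exp (K * t)"
  have ftc: "((\<lambda>t. (\<alpha> - t - (\<alpha> - t)\<^sup>2 / 2) * exp (K * t)) has_integral ?F K \<alpha> - ?F K 0) {0..\<alpha>}"
    if "K \<noteq> 0" for K :: real
    using assms that
    by (intro fundamental_theorem_of_calculus[where f = "?F K"])
      (auto intro!: derivative_eq_intros simp: field_simps power2_eq_square power3_eq_cube
        simp flip: has_real_derivative_iff_has_vector_derivative)
  have P: "pmf (D_L \<alpha>) (Suc k) =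
      1 / \<alpha> * integral {0..\<alpha>} (\<lambda>t. (\<alpha> - t - (\<alpha> - t)\<^sup>2 / 2) * (1 - exp (- t)) ^ k)" for k
    using assms by (simp add: pmf_D_L p_L_def)
  have c: "continuous_on {0..\<alpha>} (\<lambda>t. \<alpha> - t - (\<alpha> - t)\<^sup>2 / 2)" by (intro continuous_intros) auto
  have nn: "0 \<le> \<alpha> - t - (\<alpha> - t)\<^sup>2 / 2" if "t \<in> {0..\<alpha>}" for t
  proof -
    have "(\<alpha> - t) * (\<alpha> - t) \<le> (\<alpha> - t) * 1"
      using that assms by (intro mult_left_mono) auto
    then show ?thesis using that by (auto simp: power2_eq_square)
  qed
  note M = geometric_mixture_moments[OF c nn P ftc[of 2] ftc[of 3]]
  show "integrable (measure_pmf (D_L \<alpha>)) real"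
    "integrable (measure_pmf (D_L \<alpha>)) (\<lambda>d. real d * (real d + 1))"
    using M(1,3) by simp_all
  \<comment> \<open>At \<alpha> = 0 both sides are 0, the left because \<open>1 / 0 = 0\<close> and
    the right because \<open>exprel 0 = 1\<close>.\<close>
  show "measure_pmf.expectation (D_L \<alpha>) real = - 1 / 4 + \<alpha> / 4 + exprel (2 * \<alpha>) / 4"
    using M(2) by (cases "\<alpha> = 0") (simp_all add: exprel_def field_simps power2_eq_square)
  show "measure_pmf.expectation (D_L \<alpha>) (\<lambda>d. real d * (real d + 1)) =
      - 4 / 9 + \<alpha> / 3 + 4 / 9 * exprel (3 * \<alpha>)"
    using M(4) by (cases "\<alpha> = 0") (simp_all add: exprel_def field_simps power2_eq_square)
qed

lemma D_E_moments:
  assumes "0 \<le> \<alpha>" "\<alpha> \<le> 1"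
  shows "integrable (measure_pmf (D_E \<alpha>)) real"
    "measure_pmf.expectation (D_E \<alpha>) real = exprel \<alpha> - 1"
    "integrable (measure_pmf (D_E \<alpha>)) (\<lambda>d. real d * (real d + 1))"
    "measure_pmf.expectation (D_E \<alpha>) (\<lambda>d. real d * (real d + 1)) = exprel (2 * \<alpha>) - 1"
proof -
  have ftc: "((\<lambda>t. (\<alpha> - t) * exp (K * t)) has_integral
      ((\<alpha> - \<alpha>) / K + 1 / K\<^sup>2) * exp (K * \<alpha>) - ((\<alpha> - 0) / K + 1 / K\<^sup>2) * exp (K * 0)) {0..\<alpha>}"
    if "K \<noteq> 0" for K :: real
    using assms that
    by (intro fundamental_theorem_of_calculus[where f = "\<lambda>t. ((\<alpha> - t) / K + 1 / K\<^sup>2) * exp (K * t)"])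
      (auto intro!: derivative_eq_intros simp: field_simps power2_eq_square
        simp flip: has_real_derivative_iff_has_vector_derivative)
  have P: "pmf (D_E \<alpha>) (Suc k) =
      1 / \<alpha> * integral {0..\<alpha>} (\<lambda>t. (\<alpha> - t) * exp (- t) * (1 - exp (- t)) ^ k)" for k
    using assms by (simp add: pmf_D_E p_E_def)
  \<comment> \<open>The factor \<open>exp (- t)\<close> of this density lowers the exponents 2 and 3
    to 1 and 2, the growth rates of early displacements.\<close>
  have e: "(\<lambda>t. (\<alpha> - t) * exp (- t) * exp (2 * t)) = (\<lambda>t. (\<alpha> - t) * exp (1 * t))"
    "(\<lambda>t. (\<alpha> - t) * exp (- t) * exp (3 * t)) = (\<lambda>t. (\<alpha> - t) * exp (2 * t))"
    by (simp_all add: mult.assoc flip: exp_add)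
  have c: "continuous_on {0..\<alpha>} (\<lambda>t. (\<alpha> - t) * exp (- t))" by (intro continuous_intros)
  have nn: "0 \<le> (\<alpha> - t) * exp (- t)" if "t \<in> {0..\<alpha>}" for t using that by simp
  note M = geometric_mixture_moments[OF c nn P, unfolded e, OF _ ftc[of 1] ftc[of 2]]
  show "integrable (measure_pmf (D_E \<alpha>)) real"
    "integrable (measure_pmf (D_E \<alpha>)) (\<lambda>d. real d * (real d + 1))"
    using M(1,3) by simp_all
  show "measure_pmf.expectation (D_E \<alpha>) real = exprel \<alpha> - 1"
    using M(2) by (cases "\<alpha> = 0") (simp_all add: exprel_def field_simps power2_eq_square)
  show "measure_pmf.expectation (D_E \<alpha>) (\<lambda>d. real d * (real d + 1)) = exprel (2 * \<alpha>) - 1"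
    using M(4) by (cases "\<alpha> = 0") (simp_all add: exprel_def field_simps power2_eq_square)
qed

section \<open>The two moments of finite tables\<close>

lemma rising_factorial_step:
  fixes d :: nat
  shows "real d * (real (Suc d) - real d) = 1 * real d"
    and "real d * (real (Suc d) * (real (Suc d) + 1) - real d * (real d + 1)) = 2 * (real d * (real d + 1))"
  by (simp_all add: algebra_simps)

lemma d_unsuccessful_moments:
  assumes "0 < m" "n \<le> m"
  shows "measure_pmf.expectation (d_unsuccessful \<Xi> m n) real =
      - 1 / 4 + 1 / 2 * (n / m) + 1 / 4 * (1 + 2 / m) ^ n"
    "measure_pmf.expectation (d_unsuccessful \<Xi> m n) (\<lambda>d. real d * (real d + 1)) =
      - 4 / 9 + 2 / 3 * (n / m) + 4 / 9 * (1 + 3 / m) ^ n"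
proof -
  show "measure_pmf.expectation (d_unsuccessful \<Xi> m n) real =
      - 1 / 4 + 1 / 2 * (n / m) + 1 / 4 * (1 + 2 / m) ^ n"
    using expectation_d_unsuccessful_closed[OF rising_factorial_step(1) _ _ _ refl refl assms,
      where K = 2] by simp
  show "measure_pmf.expectation (d_unsuccessful \<Xi> m n) (\<lambda>d. real d * (real d + 1)) =
      - 4 / 9 + 2 / 3 * (n / m) + 4 / 9 * (1 + 3 / m) ^ n"
    using expectation_d_unsuccessful_closed[OF rising_factorial_step(2) _ _ _ refl refl assms,
      where K = 3] by simp
qed

lemma tendsto_affine:
  fixes s t :: "nat \<Rightarrow> real"
  assumes "s \<longlonglongrightarrow> x" "t \<longlonglongrightarrow> y"
  shows "(\<lambda>i. a + b * s i + c * t i) \<longlonglongrightarrow> a + b * x + c * y"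
  by (intro tendsto_intros assms)

text \<open>Averaging over insertion times halves the slope, with a correction in
  \<open>1 / m\<close> from summing 0, ..., n - 1. The geometric sum divides by K, so 1/4 becomes
  1/8 and 4/9 becomes 4/27.\<close>

lemma d_successful_Late_moments:
  assumes "0 < n" "n \<le> m"
  shows "measure_pmf.expectation (d_successful Late m n) real =
      - 1 / 4 + 1 / 4 * (n / m - 1 / m) + 1 / 8 * (m / n * ((1 + 2 / m) ^ n - 1))"
    "measure_pmf.expectation (d_successful Late m n) (\<lambda>d. real d * (real d + 1)) =
      - 4 / 9 + 1 / 3 * (n / m - 1 / m) + 4 / 27 * (m / n * ((1 + 3 / m) ^ n - 1))"
proof -
  have m: "0 < m" using assms by simp
  \<comment> \<open>The doubled minus sign exhibits the instance \<open>a = - 1 / 4\<close> of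
    \<open>sum_affine_geometric\<close>.\<close>
  have "(\<Sum>i<n. measure_pmf.expectation (d_unsuccessful Late m i) real) =
      (\<Sum>i<n. - 1 / 4 + 1 / 2 * (i / m) - - 1 / 4 * (1 + 2 / m) ^ i)"
    using assms m by (intro sum.cong refl) (simp add: d_unsuccessful_moments)
  also have "\<dots> = - 1 / 4 * n + 1 / 2 * (real n * (real n - 1) / (2 * real m)) - - 1 / 4 * m * ((1 + 2 / m) ^ n - 1) / 2"
    using m by (intro sum_affine_geometric) simp_all
  finally show "measure_pmf.expectation (d_successful Late m n) real =
      - 1 / 4 + 1 / 4 * (n / m - 1 / m) + 1 / 8 * (m / n * ((1 + 2 / m) ^ n - 1))"
    unfolding expectation_d_successful[OF m assms(1)] expectation_displacement_Late[OF m assms(2)]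
    using assms m by (simp only:) (simp add: divide_simps, simp add: algebra_simps)
  have "(\<Sum>i<n. measure_pmf.expectation (d_unsuccessful Late m i) (\<lambda>d. real d * (real d + 1))) =
      (\<Sum>i<n. - 4 / 9 + 2 / 3 * (i / m) - - 4 / 9 * (1 + 3 / m) ^ i)"
    using assms m by (intro sum.cong refl) (simp add: d_unsuccessful_moments)
  also have "\<dots> = - 4 / 9 * n + 2 / 3 * (real n * (real n - 1) / (2 * real m)) - - 4 / 9 * m * ((1 + 3 / m) ^ n - 1) / 3"
    using m by (intro sum_affine_geometric) simp_all
  finally show "measure_pmf.expectation (d_successful Late m n) (\<lambda>d. real d * (real d + 1)) =
      - 4 / 9 + 1 / 3 * (n / m - 1 / m) + 4 / 27 * (m / n * ((1 + 3 / m) ^ n - 1))"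
    unfolding expectation_d_successful[OF m assms(1)]
      expectation_displacement_Late[OF m assms(2), of "\<lambda>d. real d * (real d + 1)"]
    using assms m by (simp only:) (simp add: divide_simps, simp add: algebra_simps)
qed

lemma d_successful_Early_moments:
  assumes "0 < n" "n \<le> m"
  shows "measure_pmf.expectation (d_successful Early m n) real = m / n * ((1 + 1 / m) ^ n - 1) - 1"
    "measure_pmf.expectation (d_successful Early m n) (\<lambda>d. real d * (real d + 1)) =
      1 / 2 * (m / n * ((1 + 2 / m) ^ n - 1)) - 1"
proof -
  have m: "0 < m" using assms by simp
  show "measure_pmf.expectation (d_successful Early m n) real = m / n * ((1 + 1 / m) ^ n - 1) - 1"
    unfolding expectation_d_successful[OF m assms(1)]
    using expectation_displacement_Early[OF m rising_factorial_step(1) _ _ assms(2)] assms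
    by (simp add: diff_divide_distrib)
  show "measure_pmf.expectation (d_successful Early m n) (\<lambda>d. real d * (real d + 1)) =
      1 / 2 * (m / n * ((1 + 2 / m) ^ n - 1)) - 1"
    unfolding expectation_d_successful[OF m assms(1)]
    using expectation_displacement_Early[OF m rising_factorial_step(2) _ _ assms(2)] assms
    by (simp add: diff_divide_distrib)
qed

section \<open>Agreement of the variance formulas\<close>

lemma exp_multiples:
  fixes x :: real
  shows "exp (2 * x) = exp x * exp x" "exp (3 * x) = exp x * exp x * exp x"
    "exp (4 * x) = exp x * exp x * exp x * exp x"
  by (simp_all flip: exp_add)

lemma variance_U: "- 4 / 9 + 2 / 3 * x + 4 / 9 * exp (3 * x) - (- 1 / 4 + x / 2 + exp (2 * x) / 4)
    - (- 1 / 4 + x / 2 + exp (2 * x) / 4)\<^sup>2 =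
   - (1/16) * exp (4*x) + (4/9) * exp (3*x) - ((1/4) * x + 1/8) * exp (2*x)
              - (1/4) * x\<^sup>2 + (5/12) * x - 37/144" for x :: real
  unfolding exp_multiples power2_eq_square by (simp add: field_simps)

lemma variance_probes_U: "- 4 / 9 + 2 / 3 * x + 4 / 9 * exp (3 * x) + (1 - x)
        - (- 1 / 4 + x / 2 + exp (2 * x) / 4) - (- 1 / 4 + x / 2 + exp (2 * x) / 4 + (1 - x))\<^sup>2 =
   - (1/16) * exp (4*x) + (4/9) * exp (3*x) + ((1/4) * x - 5/8) * exp (2*x)
              - (1/4) * x\<^sup>2 - (1/12) * x + 35/144" for x :: real
  unfolding exp_multiples power2_eq_square by (simp add: field_simps)

text \<open>Over the denominator 432, \<open>exp (3 * x) - 1\<close> contributes 64 to each power of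
  \<open>exp x\<close>, the mean subtracts 54 from the two lower ones, and the cross term of the
  square returns 27: hence 64 and 37 = 64 - 54 + 27.\<close>

lemma variance_L: "x \<noteq> 0 \<Longrightarrow> - 4 / 9 + x / 3 + 4 / 9 * exprel (3 * x)
        - (- 1 / 4 + x / 4 + exprel (2 * x) / 4) - (- 1 / 4 + x / 4 + exprel (2 * x) / 4)\<^sup>2 =
  - (1/64) * ((exp (2*x) - 1) / x)\<^sup>2
              + (64 * exp (2*x) + 37 * exp x + 37) / 432 * ((exp x - 1) / x)
              - (1/16) * exp (2*x) - (1/16) * x\<^sup>2 + (5/24) * x - 7/36"
  by (simp add: exprel_def exp_multiples power2_eq_square divide_simps) (simp add: algebra_simps)

lemma variance_E: "x \<noteq> 0 \<Longrightarrow> exprel (2 * x) - 1 - (exprel x - 1) - (exprel x - 1)\<^sup>2 =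
  (x - 2) / 2 * ((exp x - 1) / x)\<^sup>2 + 2 * ((exp x - 1) / x) - 1"
  by (simp add: exprel_def exp_multiples power2_eq_square divide_simps) (simp add: algebra_simps)

theorem corollary2p4:
  fixes m n :: "nat \<Rightarrow> nat" and \<alpha> :: real
  assumes "filterlim m at_top sequentially"
    and "filterlim n at_top sequentially"
    and "\<And>i. 0 < n i \<and> n i \<le> m i"
    and "(\<lambda>i. real (n i) / real (m i)) \<longlonglongrightarrow> \<alpha>"
    and "\<alpha> \<in> {0..1}"
  shows
    "(\<forall>\<Xi>. (\<lambda>i. Var (d_unsuccessful \<Xi> (m i) (n i))) \<longlonglongrightarrow> Var (D_U \<alpha>))
     \<and> has_value_at
         (\<lambda>x. - (1/16) * exp (4*x) + (4/9) * exp (3*x) - ((1/4) * x + 1/8) * exp (2*x)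
              - (1/4) * x\<^sup>2 + (5/12) * x - 37/144)
         \<alpha> (Var (D_U \<alpha>))
     \<and> (\<lambda>i. Var (d_successful Late (m i) (n i))) \<longlonglongrightarrow> Var (D_L \<alpha>)
     \<and> has_value_at
         (\<lambda>x. - (1/64) * ((exp (2*x) - 1) / x)\<^sup>2
              + (64 * exp (2*x) + 37 * exp x + 37) / 432 * ((exp x - 1) / x)
              - (1/16) * exp (2*x) - (1/16) * x\<^sup>2 + (5/24) * x - 7/36)
         \<alpha> (Var (D_L \<alpha>))
     \<and> (\<lambda>i. Var (d_successful Early (m i) (n i))) \<longlonglongrightarrow> Var (D_E \<alpha>)
     \<and> has_value_at
         (\<lambda>x. (x - 2) / 2 * ((exp x - 1) / x)\<^sup>2 + 2 * ((exp x - 1) / x) - 1)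
         \<alpha> (Var (D_E \<alpha>))
     \<and> (\<forall>\<Xi>. (\<lambda>i. Var (probes (d_unsuccessful \<Xi> (m i) (n i)))) \<longlonglongrightarrow> Var (probes (D_U \<alpha>)))
     \<and> has_value_at
         (\<lambda>x. - (1/16) * exp (4*x) + (4/9) * exp (3*x) + ((1/4) * x - 5/8) * exp (2*x)
              - (1/4) * x\<^sup>2 - (1/12) * x + 35/144)
         \<alpha> (Var (probes (D_U \<alpha>)))"
proof -
  note nm = assms(3) and lim = assms(4)
  have a: "0 \<le> \<alpha>" "\<alpha> \<le> 1" using assms(5) by auto
  have m: "0 < m i" "n i \<le> m i" "0 < n i" for i using nm[of i] by auto
  note fin = integrable_measure_pmf_finite
  note growth = tendsto_growth[OF assms(1) nm lim] and quot = tendsto_growth_quotient[OF assms(1) nm lim]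
  \<comment> \<open>Removes the \<open>1 / m\<close> correction from the late moments.\<close>
  have m_inv: "(\<lambda>i. 1 / real (m i)) \<longlonglongrightarrow> 0"
    using filterlim_compose[OF lim_1_over_n assms(1)] by simp

  have U1: "(\<lambda>i. measure_pmf.expectation (d_unsuccessful \<Xi> (m i) (n i)) real) \<longlonglongrightarrow>
      measure_pmf.expectation (D_U \<alpha>) real" for \<Xi>
    unfolding d_unsuccessful_moments[OF m(1,2)] D_U_moments[OF a]
    by (rule tendsto_eq_rhs[OF tendsto_affine[OF lim growth[of 2]]]) simp_all
  have U2: "(\<lambda>i. measure_pmf.expectation (d_unsuccessful \<Xi> (m i) (n i)) (\<lambda>d. real d * (real d + 1))) \<longlonglongrightarrow>
      measure_pmf.expectation (D_U \<alpha>) (\<lambda>d. real d * (real d + 1))" for \<Xi>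
    unfolding d_unsuccessful_moments[OF m(1,2)] D_U_moments[OF a]
    by (rule tendsto_eq_rhs[OF tendsto_affine[OF lim growth[of 3]]]) simp_all
  have U0: "(\<lambda>i. pmf (d_unsuccessful \<Xi> (m i) (n i)) 0) \<longlonglongrightarrow> pmf (D_U \<alpha>) 0" for \<Xi>
    unfolding pmf_d_unsuccessful_0[OF m(1,2)] pmf_D_U[OF a] p_U_def
    using tendsto_diff[OF tendsto_const lim] by simp
  have L1: "(\<lambda>i. measure_pmf.expectation (d_successful Late (m i) (n i)) real) \<longlonglongrightarrow>
      measure_pmf.expectation (D_L \<alpha>) real"
    unfolding d_successful_Late_moments[OF m(3,2)] D_L_moments[OF a]
    by (rule tendsto_eq_rhs[OF tendsto_affine[OF tendsto_diff[OF lim m_inv] quot[of 2]]]) simp_all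
  have L2: "(\<lambda>i. measure_pmf.expectation (d_successful Late (m i) (n i)) (\<lambda>d. real d * (real d + 1))) \<longlonglongrightarrow>
      measure_pmf.expectation (D_L \<alpha>) (\<lambda>d. real d * (real d + 1))"
    unfolding d_successful_Late_moments[OF m(3,2)] D_L_moments[OF a]
    by (rule tendsto_eq_rhs[OF tendsto_affine[OF tendsto_diff[OF lim m_inv] quot[of 3]]]) simp_all
  have E1: "(\<lambda>i. measure_pmf.expectation (d_successful Early (m i) (n i)) real) \<longlonglongrightarrow>
      measure_pmf.expectation (D_E \<alpha>) real"
    unfolding d_successful_Early_moments[OF m(3,2)] D_E_moments[OF a]
    by (rule tendsto_eq_rhs[OF tendsto_diff[OF quot[of 1] tendsto_const]]) simp_all
  have E2: "(\<lambda>i. measure_pmf.expectation (d_successful Early (m i) (n i)) (\<lambda>d. real d * (real d + 1))) \<longlonglongrightarrow>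
      measure_pmf.expectation (D_E \<alpha>) (\<lambda>d. real d * (real d + 1))"
    unfolding d_successful_Early_moments[OF m(3,2)] D_E_moments[OF a]
    by (rule tendsto_eq_rhs[OF tendsto_diff[OF tendsto_mult[OF tendsto_const quot[of 2]] tendsto_const]])
      simp_all

  note VU = Var_eq[OF D_U_moments(1,3)[OF a]]
  note VP = Var_probes_eq[OF D_U_moments(1,3)[OF a]]
  note VL = Var_eq[OF D_L_moments(1,3)[OF a]]
  note VE = Var_eq[OF D_E_moments(1,3)[OF a]]
  \<comment> \<open>For finite tables integrability is automatic, since the laws have finite
    support.\<close>
  note VU' = Var_eq[OF fin fin, OF finite_d_unsuccessful[OF m(1)] finite_d_unsuccessful[OF m(1)]]
  note VP' = Var_probes_eq[OF fin fin, OF finite_d_unsuccessful[OF m(1)] finite_d_unsuccessful[OF m(1)]]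
  note VS' = Var_eq[OF fin fin, OF finite_d_successful[OF m(1,3)] finite_d_successful[OF m(1,3)]]

  show ?thesis
  proof (intro conjI allI)
    show "(\<lambda>i. Var (d_unsuccessful \<Xi> (m i) (n i))) \<longlonglongrightarrow> Var (D_U \<alpha>)" for \<Xi>
      unfolding VU VU' by (intro tendsto_intros U1 U2)
    show "(\<lambda>i. Var (d_successful Late (m i) (n i))) \<longlonglongrightarrow> Var (D_L \<alpha>)"
      unfolding VL VS' by (intro tendsto_intros L1 L2)
    show "(\<lambda>i. Var (d_successful Early (m i) (n i))) \<longlonglongrightarrow> Var (D_E \<alpha>)"
      unfolding VE VS' by (intro tendsto_intros E1 E2)
    show "(\<lambda>i. Var (probes (d_unsuccessful \<Xi> (m i) (n i)))) \<longlonglongrightarrow> Var (probes (D_U \<alpha>))" for \<Xi>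
      unfolding VP VP' by (intro tendsto_intros U0 U1 U2)
    show "has_value_at
         (\<lambda>x. - (1/16) * exp (4*x) + (4/9) * exp (3*x) - ((1/4) * x + 1/8) * exp (2*x)
              - (1/4) * x\<^sup>2 + (5/12) * x - 37/144)
         \<alpha> (Var (D_U \<alpha>))"
      unfolding VU D_U_moments[OF a]
      by (rule has_value_atI[OF refl _ variance_U[symmetric]])
        (auto intro!: continuous_intros isCont_o2[OF _ isCont_exprel])
    show "has_value_at
         (\<lambda>x. - (1/16) * exp (4*x) + (4/9) * exp (3*x) + ((1/4) * x - 5/8) * exp (2*x)
              - (1/4) * x\<^sup>2 - (1/12) * x + 35/144)
         \<alpha> (Var (probes (D_U \<alpha>)))"
      unfolding VP D_U_moments[OF a] pmf_D_U[OF a] p_U_def if_P[OF refl]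
      by (rule has_value_atI[OF refl _ variance_probes_U[symmetric]])
        (auto intro!: continuous_intros isCont_o2[OF _ isCont_exprel])
    \<comment> \<open>Here \<open>V\<close> is the moment formula in \<open>exprel\<close>,
      continuous at 0; the quotients of the claim agree with it away from 0.\<close>
    show "has_value_at
         (\<lambda>x. - (1/64) * ((exp (2*x) - 1) / x)\<^sup>2
              + (64 * exp (2*x) + 37 * exp x + 37) / 432 * ((exp x - 1) / x)
              - (1/16) * exp (2*x) - (1/16) * x\<^sup>2 + (5/24) * x - 7/36)
         \<alpha> (Var (D_L \<alpha>))"
      unfolding VL D_L_moments[OF a]
      by (rule has_value_atI[OF refl _ variance_L[symmetric]])
        (auto intro!: continuous_intros isCont_o2[OF _ isCont_exprel])
    show "has_value_at
         (\<lambda>x. (x - 2) / 2 * ((exp x - 1) / x)\<^sup>2 + 2 * ((exp x - 1) / x) - 1)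
         \<alpha> (Var (D_E \<alpha>))"
      unfolding VE D_E_moments[OF a]
      by (rule has_value_atI[OF refl _ variance_E[symmetric]])
        (auto intro!: continuous_intros isCont_o2[OF _ isCont_exprel])
  qed
qed

end
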